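(* Let $X\subset\mathbb{R}^n$ be a non-empty semi-monotone set, $\mathbf{f}:X\to\mathbb{R}^k$ a monotone map and $\mathbf{F}$ its graph. Then (i) the system $\mathbf{m}$ of basis sets associated with $\mathbf{f}$ is (the set of bases of) a matroid of rank $n$ on the ground set $\{x_1,\dots,x_n,y_1,\dots,y_k\}$; (ii) for each independent set $I=\{x_{j_1},\dots,x_{j_\alpha},y_{i_1},\dots,y_{i_\beta}\}$ of $\mathbf{m}$ and all $c_1,\dots,c_\alpha,b_1,\dots,b_\beta\in\mathbb{R}$, the non-empty intersections $\mathbf{F}\cap\{x_{j_1}=c_1,\dots,x_{j_\alpha}=c_\alpha,y_{i_1}=b_1,\dots,y_{i_\beta}=b_\beta\}$ are graphs of monotone maps, all having the same associated matroid $\mathbf{m}_I$ of rank $n-\alpha-\beta$ (the contraction of $\mathbf{m}$ by $I$); in particular all such non-empty intersections have dimension $n-\alpha-\beta$.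
   Context: Fix an o-minimal structure over $\mathbb{R}$; all sets and maps are definable. The empty set is connected. A coordinate cone in $\mathbb{R}^N$ is a set $\{z\mid z_{j_1}\sigma_1c_1,\dots,z_{j_m}\sigma_mc_m\}$ ($0\le m\le N$, distinct indices, $\sigma_i\in\{<,=,>\}$, $c_i\in\mathbb{R}$). A set is semi-monotone if it is open, bounded, definable and meets every coordinate cone in a connected set. A definable $f$ on open $X\subset\mathbb{R}^n$ is strictly increasing/decreasing in $x_j$ if $f(\mathbf{x})<f(\mathbf{y})$ / $f(\mathbf{x})>f(\mathbf{y})$ whenever $\mathbf{x},\mathbf{y}\in X$ differ only in coordinate $j$ with $x_j<y_j$, and independent of $x_j$ if $f(\mathbf{x})=f(\mathbf{y})$ for such pairs. A bounded upper semicontinuous $f$ on non-empty semi-monotone $X$ is submonotone if all $\{f<b\}$ are semi-monotone, supermonotone if $-f$ is submonotone; $f$ is a monotone function if it is sub- and supermonotone and for each $j$ strictly increasing in, strictly decreasing in, or independent of $x_j$. For $X\subset\mathbb{R}^n$ non-empty semi-monotone and $\mathbf{f}=(f_1,\dots,f_k):X\to\mathbb{R}^k$ continuous bounded with graph $\mathbf{F}=\{(\mathbf{x},\mathbf{f}(\mathbf{x}))\}$ (coordinates $x_1,\dots,x_n,y_1,\dots,y_k$), a set $\{x_{j_1},\dots,x_{j_\alpha},y_{i_1},\dots,y_{i_\beta}\}$ with $\alpha+\beta=n$ is a basis set if $(x_{j_1},\dots,x_{j_\alpha},f_{i_1},\dots,f_{i_\beta}):X\to\mathbb{R}^n$ is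 injective; these form the system of basis sets of $\mathbf{f}$. $\mathbf{f}$ is a monotone map, by induction on $n$: for $n=1$ if each $f_i$ is a monotone function; for $n>1$ if for all $i,j$ with $f_i$ not independent of $x_j$: (i) each non-empty $\mathbf{F}\cap\{y_i=b\}$ (viewed in the coordinates other than $y_i$) is the graph of a monotone map $\mathbf{f}_{i,j,b}$ from a semi-monotone subset of the span of $\{x_1,\dots,x_n\}\setminus\{x_j\}$ to the span of $y_1,\dots,y_{i-1},x_j,y_{i+1},\dots,y_k$; (ii) the system of basis sets of $\mathbf{f}_{i,j,b}$ is independent of $b$. A subset of an affine coordinate subspace (fixing some coordinates) is called the graph of a monotone map if, in the remaining free coordinates, after splitting them into a set $A$ and its complement $B$, it equals $\{(u,g(u))\mid u\in Y\}$ with $Y$ a non-empty semi-monotone set in the span of $A$ and $g$ a monotone map into the span of $B$. An independent set of a matroid is a subset of a basis; contraction is the standard matroid operation. *)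

theory Defs
  imports "HOL-Analysis.Analysis"
begin

section \<open>O-minimal structures\<close>

text \<open>
  An o-minimal structure over the reals is an o-minimal expansion of the real field, given as in
  van den Dries and Miller by the families \<open>S n\<close> of its definable subsets of \<open>\<real>^n\<close>.
  Here (and only here) points of \<open>\<real>^n\<close> are lists of length \<open>n\<close>. Polynomials, the order and all
  real constants are available: constants because singletons are intervals, the order because
  squares are definable.
\<close>

definition o_minimal_structure :: "(nat \<Rightarrow> real list set set) \<Rightarrow> bool" where
  "o_minimal_structure S \<longleftrightarrow>
     \<comment> \<open>Boolean algebras of subsets of \<open>\<real>^n\<close>\<close>
     (\<forall>n. \<forall>A\<in>S n. A \<subseteq> {xs. length xs = n}) \<and>
     (\<forall>n. {} \<in> S n) \<and>
     (\<forall>n. \<forall>A\<in>S n. {xs. length xs = n} - A \<in> S n) \<and>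
     (\<forall>n. \<forall>A\<in>S n. \<forall>B\<in>S n. A \<union> B \<in> S n) \<and>
     \<comment> \<open>diagonals\<close>
     (\<forall>n i j. i < j \<and> j < n \<longrightarrow> {xs. length xs = n \<and> xs ! i = xs ! j} \<in> S n) \<and>
     \<comment> \<open>products with the line, and projections\<close>
     (\<forall>n. \<forall>A\<in>S n. {x # xs | x xs. xs \<in> A} \<in> S (Suc n) \<and> {xs @ [x] | x xs. xs \<in> A} \<in> S (Suc n)) \<and>
     (\<forall>n. \<forall>A\<in>S (Suc n). butlast ` A \<in> S n) \<and>
     \<comment> \<open>graphs of addition and multiplication\<close>
     {[x, y, x + y] | x y. True} \<in> S 3 \<and>
     {[x, y, x * y] | x y. True} \<in> S 3 \<and>
     \<comment> \<open>o-minimality; intervals may be empty, degenerate or unbounded\<close>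
     S 1 = {(\<lambda>x. [x]) ` \<Union>J | J. finite J \<and> (\<forall>T\<in>J. is_interval T)}"

section \<open>Coordinate spaces\<close>

text \<open>
  Coordinates are labels of an arbitrary type \<open>'v\<close>. For a finite set \<open>I\<close> of labels, the space
  spanned by the coordinates in \<open>I\<close> is \<open>topspace (powertop_real I)\<close>, i.e. the functions
  \<open>'v \<Rightarrow> real\<close> that are \<open>undefined\<close> outside \<open>I\<close>, with the product topology.
\<close>

text \<open>
  Definability is with respect to some enumeration of the coordinates. The choice of the
  enumeration is irrelevant since definable families are closed under permuting coordinates.
\<close>

definition definable_set :: "(nat \<Rightarrow> real list set set) \<Rightarrow> 'v set \<Rightarrow> ('v \<Rightarrow> real) set \<Rightarrow> bool" where
  "definable_set S I Z \<longleftrightarrow>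
     Z \<subseteq> topspace (powertop_real I) \<and>
     (\<exists>vs. distinct vs \<and> set vs = I \<and> (\<lambda>z. map z vs) ` Z \<in> S (length vs))"

definition definable_fun ::
    "(nat \<Rightarrow> real list set set) \<Rightarrow> 'v set \<Rightarrow> ('v \<Rightarrow> real) set \<Rightarrow> (('v \<Rightarrow> real) \<Rightarrow> real) \<Rightarrow> bool" where
  "definable_fun S I X f \<longleftrightarrow>
     X \<subseteq> topspace (powertop_real I) \<and>
     (\<exists>vs. distinct vs \<and> set vs = I \<and> (\<lambda>x. map x vs @ [f x]) ` X \<in> S (Suc (length vs)))"

definition bounded_in :: "'v set \<Rightarrow> ('v \<Rightarrow> real) set \<Rightarrow> bool" where
  "bounded_in I Z \<longleftrightarrow> (\<exists>M. \<forall>z\<in>Z. \<forall>i\<in>I. \<bar>z i\<bar> \<le> M)"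

text \<open>
  The dimension of a non-empty definable set: the largest number \<open>d\<close> such that the projection to
  some \<open>d\<close> of the coordinates has non-empty interior. (Projecting to no coordinates shows that
  the maximum is over a non-empty set; the value for \<open>Z = {}\<close> is meaningless.)
\<close>

definition definable_dim :: "'v set \<Rightarrow> ('v \<Rightarrow> real) set \<Rightarrow> nat" where
  "definable_dim I Z =
     Max {card T | T. T \<subseteq> I \<and> powertop_real T interior_of ((\<lambda>z. restrict z T) ` Z) \<noteq> {}}"

section \<open>Semi-monotone sets\<close>

definition coordinate_cone :: "'v set \<Rightarrow> ('v \<Rightarrow> real) set \<Rightarrow> bool" where
  "coordinate_cone I C \<longleftrightarrow>
     (\<exists>J \<sigma> c. J \<subseteq> I \<and> (\<forall>j\<in>J. \<sigma> j \<in> {(<), (=), (>)}) \<and>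
        C = {z \<in> topspace (powertop_real I). \<forall>j\<in>J. \<sigma> j (z j) (c j :: real)})"

definition semi_monotone :: "(nat \<Rightarrow> real list set set) \<Rightarrow> 'v set \<Rightarrow> ('v \<Rightarrow> real) set \<Rightarrow> bool" where
  "semi_monotone S I X \<longleftrightarrow>
     openin (powertop_real I) X \<and> bounded_in I X \<and> definable_set S I X \<and>
     (\<forall>C. coordinate_cone I C \<longrightarrow> connectedin (powertop_real I) (X \<inter> C))"

section \<open>Monotone functions\<close>

definition strictly_increasing_in ::
    "'v set \<Rightarrow> ('v \<Rightarrow> real) set \<Rightarrow> (('v \<Rightarrow> real) \<Rightarrow> real) \<Rightarrow> 'v \<Rightarrow> bool" where
  "strictly_increasing_in I X f j \<longleftrightarrow>
     (\<forall>x\<in>X. \<forall>y\<in>X. (\<forall>i\<in>I - {j}. x i = y i) \<and> x j < y j \<longrightarrow> f x < f y)"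

definition strictly_decreasing_in ::
    "'v set \<Rightarrow> ('v \<Rightarrow> real) set \<Rightarrow> (('v \<Rightarrow> real) \<Rightarrow> real) \<Rightarrow> 'v \<Rightarrow> bool" where
  "strictly_decreasing_in I X f j \<longleftrightarrow>
     (\<forall>x\<in>X. \<forall>y\<in>X. (\<forall>i\<in>I - {j}. x i = y i) \<and> x j < y j \<longrightarrow> f x > f y)"

definition independent_of ::
    "'v set \<Rightarrow> ('v \<Rightarrow> real) set \<Rightarrow> (('v \<Rightarrow> real) \<Rightarrow> real) \<Rightarrow> 'v \<Rightarrow> bool" where
  "independent_of I X f j \<longleftrightarrow>
     (\<forall>x\<in>X. \<forall>y\<in>X. (\<forall>i\<in>I - {j}. x i = y i) \<and> x j < y j \<longrightarrow> f x = f y)"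

definition upper_semicontinuous ::
    "'v set \<Rightarrow> ('v \<Rightarrow> real) set \<Rightarrow> (('v \<Rightarrow> real) \<Rightarrow> real) \<Rightarrow> bool" where
  "upper_semicontinuous I X f \<longleftrightarrow>
     (\<forall>b. openin (subtopology (powertop_real I) X) {x \<in> X. f x < b})"

definition submonotone ::
    "(nat \<Rightarrow> real list set set) \<Rightarrow> 'v set \<Rightarrow> ('v \<Rightarrow> real) set \<Rightarrow> (('v \<Rightarrow> real) \<Rightarrow> real) \<Rightarrow> bool" where
  "submonotone S I X f \<longleftrightarrow>
     X \<noteq> {} \<and> semi_monotone S I X \<and> definable_fun S I X f \<and>
     bounded (f ` X) \<and> upper_semicontinuous I X f \<and>
     (\<forall>b. semi_monotone S I {x \<in> X. f x < b})"

definition supermonotone ::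
    "(nat \<Rightarrow> real list set set) \<Rightarrow> 'v set \<Rightarrow> ('v \<Rightarrow> real) set \<Rightarrow> (('v \<Rightarrow> real) \<Rightarrow> real) \<Rightarrow> bool" where
  "supermonotone S I X f \<longleftrightarrow> submonotone S I X (\<lambda>x. - f x)"

definition monotone_function ::
    "(nat \<Rightarrow> real list set set) \<Rightarrow> 'v set \<Rightarrow> ('v \<Rightarrow> real) set \<Rightarrow> (('v \<Rightarrow> real) \<Rightarrow> real) \<Rightarrow> bool" where
  "monotone_function S I X f \<longleftrightarrow>
     submonotone S I X f \<and> supermonotone S I X f \<and>
     (\<forall>j\<in>I. strictly_increasing_in I X f j \<or> strictly_decreasing_in I X f j \<or> independent_of I X f j)"

section \<open>Monotone maps\<close>

text \<open>
  A map from \<open>X\<close> in the span of \<open>A\<close> to the span of \<open>B\<close>, where \<open>A\<close> and \<open>B\<close> are disjoint, has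
  components \<open>\<lambda>x. f x i\<close> for \<open>i \<in> B\<close>; its graph lies in the span of \<open>A \<union> B\<close>.
\<close>

definition map_graph ::
    "'v set \<Rightarrow> 'v set \<Rightarrow> ('v \<Rightarrow> real) set \<Rightarrow> (('v \<Rightarrow> real) \<Rightarrow> 'v \<Rightarrow> real) \<Rightarrow> ('v \<Rightarrow> real) set" where
  "map_graph A B X f = (\<lambda>x. merge A B (x, f x)) ` X"

definition basis_sets ::
    "'v set \<Rightarrow> 'v set \<Rightarrow> ('v \<Rightarrow> real) set \<Rightarrow> (('v \<Rightarrow> real) \<Rightarrow> 'v \<Rightarrow> real) \<Rightarrow> 'v set set" where
  "basis_sets A B X f =
     {T. T \<subseteq> A \<union> B \<and> card T = card A \<and> inj_on (\<lambda>x. restrict (merge A B (x, f x)) T) X}"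

definition continuous_bounded_map ::
    "(nat \<Rightarrow> real list set set) \<Rightarrow> 'v set \<Rightarrow> 'v set \<Rightarrow> ('v \<Rightarrow> real) set \<Rightarrow>
     (('v \<Rightarrow> real) \<Rightarrow> 'v \<Rightarrow> real) \<Rightarrow> bool" where
  "continuous_bounded_map S A B X f \<longleftrightarrow>
     finite A \<and> finite B \<and> A \<inter> B = {} \<and>
     X \<noteq> {} \<and> semi_monotone S A X \<and>
     continuous_map (subtopology (powertop_real A) X) (powertop_real B) f \<and>
     bounded_in B (f ` X) \<and> definable_set S (A \<union> B) (map_graph A B X f)"

text \<open>
  The induction on \<open>card A\<close>. Case \<open>point\<close> is the convention that every map from the one-point
  space spanned by no coordinates is monotone; it is not used by the other two cases.
  In case \<open>step\<close>, the family \<open>M\<close> is chosen before \<open>b\<close>: this is the condition that the system of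
  basis sets does not depend on \<open>b\<close>.
\<close>

inductive monotone_coord_map ::
    "(nat \<Rightarrow> real list set set) \<Rightarrow> 'v set \<Rightarrow> 'v set \<Rightarrow> ('v \<Rightarrow> real) set \<Rightarrow>
     (('v \<Rightarrow> real) \<Rightarrow> 'v \<Rightarrow> real) \<Rightarrow> bool" for S where
  point: "\<lbrakk>continuous_bounded_map S A B X f; card A = 0\<rbrakk> \<Longrightarrow> monotone_coord_map S A B X f"
| line: "\<lbrakk>continuous_bounded_map S A B X f; card A = 1;
     \<forall>i\<in>B. monotone_function S A X (\<lambda>x. f x i)\<rbrakk> \<Longrightarrow> monotone_coord_map S A B X f"
| step: "\<lbrakk>continuous_bounded_map S A B X f; card A > 1;
     \<forall>i\<in>B. \<forall>j\<in>A. \<not> independent_of A X (\<lambda>x. f x i) j \<longrightarrow>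
       (\<exists>M. \<forall>b. {z \<in> map_graph A B X f. z i = b} \<noteq> {} \<longrightarrow>
         (\<exists>Y g. monotone_coord_map S (A - {j}) (insert j (B - {i})) Y g \<and>
           (\<lambda>z. restrict z (A \<union> B - {i})) ` {z \<in> map_graph A B X f. z i = b}
             = map_graph (A - {j}) (insert j (B - {i})) Y g \<and>
           basis_sets (A - {j}) (insert j (B - {i})) Y g = M))\<rbrakk>
   \<Longrightarrow> monotone_coord_map S A B X f"

text \<open>
  For a subset \<open>Z\<close> of the span of \<open>E\<close> on which the coordinates in \<open>I\<close> are constant: in the free
  coordinates, split into \<open>A\<close> and \<open>B\<close>, the set \<open>Z\<close> is the graph of the monotone map \<open>g\<close> on \<open>Y\<close>.
\<close>

definition graph_of_monotone_map ::
    "(nat \<Rightarrow> real list set set) \<Rightarrow> 'v set \<Rightarrow> 'v set \<Rightarrow> ('v \<Rightarrow> real) set \<Rightarrow>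
     'v set \<Rightarrow> 'v set \<Rightarrow> ('v \<Rightarrow> real) set \<Rightarrow> (('v \<Rightarrow> real) \<Rightarrow> 'v \<Rightarrow> real) \<Rightarrow> bool" where
  "graph_of_monotone_map S E I Z A B Y g \<longleftrightarrow>
     A \<union> B = E - I \<and> A \<inter> B = {} \<and> Y \<noteq> {} \<and> semi_monotone S A Y \<and> monotone_coord_map S A B Y g \<and>
     (\<lambda>z. restrict z (E - I)) ` Z = map_graph A B Y g"

section \<open>Matroids, given by their bases\<close>

definition matroid :: "'v set \<Rightarrow> 'v set set \<Rightarrow> bool" where
  "matroid E m \<longleftrightarrow>
     finite E \<and> m \<noteq> {} \<and> (\<forall>T\<in>m. T \<subseteq> E) \<and>
     (\<forall>T\<in>m. \<forall>U\<in>m. \<forall>v\<in>T - U. \<exists>w\<in>U - T. insert w (T - {v}) \<in> m)"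

definition matroid_of_rank :: "'v set \<Rightarrow> 'v set set \<Rightarrow> nat \<Rightarrow> bool" where
  "matroid_of_rank E m r \<longleftrightarrow> matroid E m \<and> (\<forall>T\<in>m. card T = r)"

definition independent_in :: "'v set set \<Rightarrow> 'v set \<Rightarrow> bool" where
  "independent_in m I \<longleftrightarrow> (\<exists>T\<in>m. I \<subseteq> T)"

definition matroid_dual :: "'v set \<Rightarrow> 'v set set \<Rightarrow> 'v set set" where
  "matroid_dual E m = (\<lambda>T. E - T) ` m"

text \<open>The bases of a deletion are the maximal independent sets avoiding \<open>I\<close>.\<close>

definition matroid_deletion :: "'v set set \<Rightarrow> 'v set \<Rightarrow> 'v set set" where
  "matroid_deletion m I = {T - I | T. T \<in> m \<and> \<not> (\<exists>U\<in>m. T - I \<subset> U - I)}"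

definition matroid_contraction :: "'v set \<Rightarrow> 'v set set \<Rightarrow> 'v set \<Rightarrow> 'v set set" where
  "matroid_contraction E m I = matroid_dual (E - I) (matroid_deletion (matroid_dual E m) I)"

section \<open>The coordinates of the graph of a map from \<open>\<real>^n\<close> to \<open>\<real>^k\<close>\<close>

datatype coord = x_coord nat | y_coord nat

definition x_coords :: "nat \<Rightarrow> coord set" where
  "x_coords n = x_coord ` {1..n}"

definition y_coords :: "nat \<Rightarrow> coord set" where
  "y_coords k = y_coord ` {1..k}"

end

(*
  Only the graph matters: a set T of n coordinates is a basis iff the projection of the graph to T is
  injective. If the coordinate v is not constant on the graph, then all non-empty slices z_v = c are
  graphs of monotone maps in one dimension less, with basis sets independent of c; these are therefore
  the sets T - {v} with v in T in m. For v = y_i this is the definition of a monotone map (every non-constant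
  f_i depends on some x_j, since X is open and connected); for v = x_j it is proved by induction on n,
  slicing first by some y_i and then by x_j.

  The rest is combinatorial induction on n. Bases T, U with a common element are exchanged inside a
  slice. If T and U are disjoint, let t in T and u in U: either some basis contains both t and u, and
  then a slice by u gives a basis V with t in V and V contained in U + t; or t and u are functions of
  each other, and V = U - u + t is a basis. As T and V share t, this reduces to the first case.
*)

theory Submission
  imports Defs
begin

text \<open>The definition of a monotone map speaks only of slices y_i = b, whereas fixing the
  coordinates of an arbitrary independent set also requires slices x_j = c. A slice x_j = c inherits
  the recursive condition from double slices as long as its domain has dimension at least two. Once
  the domain is a line, the definition changes its form and asks for monotone functions, so sublevel
  sets must be shown to be definable and semi-monotone. This is what the closure properties of
  definable sets and the order of the line are for. Monotonicity on the line comes from injectivity: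
  if f_i depends on x_l, then y_i and the x-coordinates other than x_l determine the point.

  The locale \<open>slice_class\<close> collects what the combinatorial part uses of monotone maps.
  It slices only at coordinates that are not constant on the graph; fixing a constant one would not
  lower the rank, and such coordinates are the loops of the matroid. The dimension of an
  intersection is bounded by slicing as well, applied to the corners of a box inside a
  projection.\<close>

section \<open>Contraction of matroids\<close>

lemma matroid_finite:
  assumes "matroid E m" "T \<in> m"
  shows "finite T"
  using assms unfolding matroid_def by (meson finite_subset)

text \<open>Elements of T outside I \<union> U are exchanged one at a time for elements of U. Each
  exchange shrinks T - (I \<union> U) and never removes an element of I.\<close>

lemma matroid_basis_between:
  assumes m: "matroid E m" and "T \<in> m" "U \<in> m" "I \<subseteq> T"
  shows "\<exists>V\<in>m. I \<subseteq> V \<and> V \<subseteq> I \<union> U"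
  using assms(2,4)
proof (induction "card (T - (I \<union> U))" arbitrary: T rule: less_induct)
  case less
  show ?case
  proof (cases "T \<subseteq> I \<union> U")
    case True
    then show ?thesis using less.prems by blast
  next
    case False
    then obtain v where v: "v \<in> T" "v \<notin> I" "v \<notin> U" by blast
    then obtain w where w: "w \<in> U - T" "insert w (T - {v}) \<in> m"
      using m less.prems(1) \<open>U \<in> m\<close> unfolding matroid_def by blast
    have "insert w (T - {v}) - (I \<union> U) \<subset> T - (I \<union> U)"
      using v w(1) by auto
    then have "card (insert w (T - {v}) - (I \<union> U)) < card (T - (I \<union> U))"
      using matroid_finite[OF m less.prems(1)] by (simp add: psubset_card_mono)
    then show ?thesis
      using less.hyps w(2) v(2) less.prems(2) by blast
  qed
qed

text \<open>In terms of complements, maximality of E - T - I means that T - I is minimal. As I is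
  independent, some basis V contains I and lies in I \<union> T; minimality and equal cardinality
  then force T = V.\<close>

lemma matroid_contraction_independent:
  assumes m: "matroid_of_rank E m n" and I: "independent_in m I"
  shows "matroid_contraction E m I = {T - I | T. T \<in> m \<and> I \<subseteq> T}"
proof -
  from m have mat: "matroid E m" and card: "\<And>T. T \<in> m \<Longrightarrow> card T = n"
    by (auto simp: matroid_of_rank_def)
  have sub: "T \<subseteq> E" if "T \<in> m" for T
    using mat that by (auto simp: matroid_def)
  have fin: "finite T" if "T \<in> m" for T
    using mat that by (rule matroid_finite)
  have maximal: "(\<not> (\<exists>U\<in>m. E - T - I \<subset> E - U - I)) \<longleftrightarrow> I \<subseteq> T" if T: "T \<in> m" for T
  proof
    assume max: "\<not> (\<exists>U\<in>m. E - T - I \<subset> E - U - I)"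
    from I obtain T0 where "T0 \<in> m" "I \<subseteq> T0" by (auto simp: independent_in_def)
    with matroid_basis_between[OF mat _ T] obtain V where V: "V \<in> m" "I \<subseteq> V" "V \<subseteq> I \<union> T"
      by blast
    then have "E - T - I \<subseteq> E - V - I" by blast
    with max V(1) have "E - T - I = E - V - I" by blast
    then have "T \<subseteq> V" using V sub[OF T] by blast
    then have "T = V" using card[OF T] card[OF V(1)] fin[OF V(1)] by (simp add: card_subset_eq)
    then show "I \<subseteq> T" using V by simp
  next
    assume IT: "I \<subseteq> T"
    show "\<not> (\<exists>U\<in>m. E - T - I \<subset> E - U - I)"
    proof
      assume "\<exists>U\<in>m. E - T - I \<subset> E - U - I"
      then obtain U where U: "U \<in> m" "E - T - I \<subset> E - U - I" by blast
      then have "U \<subseteq> T" using sub IT by blast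
      then have "U = T" using card[OF T] card[OF U(1)] fin[OF T] by (simp add: card_subset_eq)
      then show False using U by simp
    qed
  qed
  have "matroid_deletion (matroid_dual E m) I = {E - T - I | T. T \<in> m \<and> I \<subseteq> T}"
  proof (intro set_eqI iffI)
    fix D assume "D \<in> matroid_deletion (matroid_dual E m) I"
    then obtain T where T: "T \<in> m" "D = E - T - I" "\<not> (\<exists>U\<in>m. E - T - I \<subset> E - U - I)"
      unfolding matroid_deletion_def matroid_dual_def by auto
    with maximal show "D \<in> {E - T - I | T. T \<in> m \<and> I \<subseteq> T}" by blast
  next
    fix D assume "D \<in> {E - T - I | T. T \<in> m \<and> I \<subseteq> T}"
    then obtain T where T: "T \<in> m" "D = E - T - I" "I \<subseteq> T" by blast
    with maximal have "\<not> (\<exists>U\<in>m. E - T - I \<subset> E - U - I)" by simp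
    with T show "D \<in> matroid_deletion (matroid_dual E m) I"
      unfolding matroid_deletion_def matroid_dual_def by auto
  qed
  then have "matroid_contraction E m I = (\<lambda>T. E - I - (E - T - I)) ` {T \<in> m. I \<subseteq> T}"
    unfolding matroid_contraction_def by (auto simp: matroid_dual_def)
  also have "\<dots> = (\<lambda>T. T - I) ` {T \<in> m. I \<subseteq> T}"
    by (rule image_cong) (use sub in auto)
  finally show ?thesis by auto
qed

text \<open>Exchanges between bases that contain I do not touch I: the removed v comes from T - I,
  and the new w lies outside T, which contains I.\<close>

lemma matroid_of_rank_contraction:
  assumes m: "matroid_of_rank E m n" and I: "independent_in m I"
  shows "matroid_of_rank (E - I) {T - I | T. T \<in> m \<and> I \<subseteq> T} (n - card I)"
proof -
  from m have mat: "matroid E m" and card: "\<And>T. T \<in> m \<Longrightarrow> card T = n"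
    by (auto simp: matroid_of_rank_def)
  have fin: "finite T" if "T \<in> m" for T
    using mat that by (rule matroid_finite)
  let ?m = "{T - I | T. T \<in> m \<and> I \<subseteq> T}"
  have exchange: "\<exists>w\<in>U' - T'. insert w (T' - {v}) \<in> ?m"
    if "T' \<in> ?m" "U' \<in> ?m" "v \<in> T' - U'" for T' U' v
  proof -
    from that obtain T U where T: "T \<in> m" "I \<subseteq> T" "T' = T - I" and U: "U \<in> m" "I \<subseteq> U" "U' = U - I"
      by blast
    have "v \<in> T - U" using that(3) T U by blast
    then obtain w where w: "w \<in> U - T" "insert w (T - {v}) \<in> m"
      using mat T(1) U(1) unfolding matroid_def by blast
    have "insert w (T - {v}) - I = insert w (T' - {v})" "I \<subseteq> insert w (T - {v})"
      using w(1) that(3) T U by auto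
    then have "insert w (T' - {v}) \<in> ?m" using w(2) by blast
    then show ?thesis using w(1) T U by blast
  qed
  have card': "card T' = n - card I" if "T' \<in> ?m" for T'
    using that card fin by (auto simp: card_Diff_subset finite_subset)
  have fin': "finite (E - I)" using mat unfolding matroid_def by auto
  have sub: "T' \<subseteq> E - I" if "T' \<in> ?m" for T'
    using mat that unfolding matroid_def by auto
  have ne: "?m \<noteq> {}"
    using I unfolding independent_in_def by blast
  show ?thesis
    unfolding matroid_of_rank_def matroid_def by (intro conjI ballI) (rule fin', rule ne, (rule sub exchange card'; assumption)+)
qed

section \<open>Sets of points closed under slicing\<close>

text \<open>In a \<open>slice_class\<close>, the v in E with this property are the loops, the
  elements that belong to no basis.\<close>

definition constant_at :: "'v \<Rightarrow> ('v \<Rightarrow> 'a) set \<Rightarrow> bool" where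
  "constant_at v F \<longleftrightarrow> (\<forall>z\<in>F. \<forall>w\<in>F. z v = w v)"

text \<open>The fixed coordinate is also removed from the points, so a slice is a set of points over
  the smaller ground set E - {v} and slicing can be iterated.\<close>

definition slice :: "'v set \<Rightarrow> 'v \<Rightarrow> 'a \<Rightarrow> ('v \<Rightarrow> 'a) set \<Rightarrow> ('v \<Rightarrow> 'a) set" where
  "slice E v c F = (\<lambda>z. restrict z (E - {v})) ` {z \<in> F. z v = c}"

text \<open>The rank n is an argument because a bare set of points carries no splitting into domain
  and range coordinates from which it could be read off.\<close>

definition bases :: "nat \<Rightarrow> 'v set \<Rightarrow> ('v \<Rightarrow> 'a) set \<Rightarrow> 'v set set" where
  "bases n E F = {T. T \<subseteq> E \<and> card T = n \<and> inj_on (\<lambda>z. restrict z T) F}"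

lemma restrict_eq_iff: "restrict z T = restrict w T \<longleftrightarrow> (\<forall>i\<in>T. z i = w i)"
  by (auto simp: restrict_def fun_eq_iff)

lemma inj_on_slice:
  assumes F: "F \<subseteq> extensional E" and T: "T \<subseteq> E - {v}"
  shows "inj_on (\<lambda>z. restrict z T) (slice E v c F) \<longleftrightarrow>
    (\<forall>z\<in>F. \<forall>w\<in>F. z v = c \<and> w v = c \<and> (\<forall>i\<in>T. z i = w i) \<longrightarrow> z = w)"
proof -
  have eq: "z = w" if "z \<in> F" "w \<in> F" "z v = w v" "\<forall>i\<in>E - {v}. z i = w i" for z w
  proof (rule extensionalityI[of _ E])
    show "z \<in> extensional E" "w \<in> extensional E" using that F by auto
    show "z i = w i" if "i \<in> E" for i using that \<open>z v = w v\<close> \<open>\<forall>i\<in>E - {v}. z i = w i\<close> by blast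
  qed
  have r: "restrict (restrict z (E - {v})) T = restrict z T" for z :: "'a \<Rightarrow> 'b"
    using T by (simp add: Int_absorb1)
  show ?thesis
  proof
    assume inj: "inj_on (\<lambda>z. restrict z T) (slice E v c F)"
    show "\<forall>z\<in>F. \<forall>w\<in>F. z v = c \<and> w v = c \<and> (\<forall>i\<in>T. z i = w i) \<longrightarrow> z = w"
    proof (intro ballI impI)
      fix z w assume zw: "z \<in> F" "w \<in> F" "z v = c \<and> w v = c \<and> (\<forall>i\<in>T. z i = w i)"
      then have "restrict z (E - {v}) \<in> slice E v c F" "restrict w (E - {v}) \<in> slice E v c F"
        by (auto simp: slice_def)
      moreover have "restrict (restrict z (E - {v})) T = restrict (restrict w (E - {v})) T"
        unfolding r using zw by (simp add: restrict_eq_iff)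
      ultimately have "restrict z (E - {v}) = restrict w (E - {v})"
        using inj by (meson inj_onD)
      then show "z = w" using eq[of z w] zw by (simp add: restrict_eq_iff)
    qed
  next
    assume *: "\<forall>z\<in>F. \<forall>w\<in>F. z v = c \<and> w v = c \<and> (\<forall>i\<in>T. z i = w i) \<longrightarrow> z = w"
    show "inj_on (\<lambda>z. restrict z T) (slice E v c F)"
    proof (rule inj_onI)
      fix x y assume xy: "x \<in> slice E v c F" "y \<in> slice E v c F" "restrict x T = restrict y T"
      then obtain z w where zw: "z \<in> F" "z v = c" "x = restrict z (E - {v})"
          "w \<in> F" "w v = c" "y = restrict w (E - {v})" by (auto simp: slice_def)
      then have "\<forall>i\<in>T. z i = w i" using xy(3) unfolding zw r restrict_eq_iff by simp
      then show "x = y" using * zw by blast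
    qed
  qed
qed

text \<open>Points that agree at v lie in a common slice, so injectivity on
  \<open>insert v T\<close> splits into one condition for each value c. Values that are not attained
  give empty slices and hence no condition.\<close>

lemma inj_on_insert:
  assumes "F \<subseteq> extensional E" "T \<subseteq> E - {v}"
  shows "inj_on (\<lambda>z. restrict z (insert v T)) F \<longleftrightarrow>
    (\<forall>c. inj_on (\<lambda>z. restrict z T) (slice E v c F))"
  unfolding inj_on_slice[OF assms] by (auto simp: inj_on_def restrict_eq_iff)

lemma slice_empty_iff: "slice E v c F = {} \<longleftrightarrow> \<not> (\<exists>z\<in>F. z v = c)"
  by (auto simp: slice_def)

text \<open>\<open>G n E F\<close> is to be read as: F is a set of points over E in the class, of
  rank n. Slicing at a non-constant coordinate lowers the rank by exactly one, and
  \<open>slice_bases\<close> is the abstract form of the condition that systems of basis sets do not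
  depend on b.\<close>

locale slice_class =
  fixes G :: "nat \<Rightarrow> 'v set \<Rightarrow> ('v \<Rightarrow> 'a) set \<Rightarrow> bool"
  assumes finite_ground: "G n E F \<Longrightarrow> finite E"
    and points_extensional: "G n E F \<Longrightarrow> F \<subseteq> extensional E"
    and nonempty: "G n E F \<Longrightarrow> F \<noteq> {}"
    and rank_0: "G 0 E F \<Longrightarrow> constant_at v F"
    and rank_Suc: "G (Suc n) E F \<Longrightarrow> \<exists>v\<in>E. \<not> constant_at v F"
    and slice_Suc: "G (Suc n) E F \<Longrightarrow> v \<in> E \<Longrightarrow> \<not> constant_at v F \<Longrightarrow> z \<in> F \<Longrightarrow>
      G n (E - {v}) (slice E v (z v) F)"
    and slice_bases: "G (Suc n) E F \<Longrightarrow> v \<in> E \<Longrightarrow> \<not> constant_at v F \<Longrightarrow> z \<in> F \<Longrightarrow> w \<in> F \<Longrightarrow>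
      bases n (E - {v}) (slice E v (z v) F) = bases n (E - {v}) (slice E v (w v) F)"
begin

section \<open>Bases under slicing, and the rank as the least size of a set of coordinates that
  separates points\<close>

lemma bases_slice:
  assumes G: "G (Suc n) E F" and v: "v \<in> E" "\<not> constant_at v F" and z: "z \<in> F"
  shows "bases n (E - {v}) (slice E v (z v) F) = {T - {v} | T. T \<in> bases (Suc n) E F \<and> v \<in> T}"
proof -
  note ext = points_extensional[OF G]
  have fin: "finite T" if "T \<subseteq> E" for T
    using finite_ground[OF G] that by (rule finite_subset[rotated])
  have ins: "insert v T \<in> bases (Suc n) E F"
    if "T \<in> bases n (E - {v}) (slice E v (z v) F)" for T
  proof -
    have T: "T \<subseteq> E - {v}" "card T = n" using that by (auto simp: bases_def)
    \<comment> \<open>Here \<open>slice_bases\<close> transfers injectivity from the slice through z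
      to every other non-empty slice, as \<open>inj_on_insert\<close> demands.\<close>
    have "inj_on (\<lambda>z. restrict z T) (slice E v c F)" for c
    proof (cases "\<exists>w\<in>F. w v = c")
      case True
      then show ?thesis using slice_bases[OF G v z] that by (auto simp: bases_def)
    next
      case False
      then have "slice E v c F = {}" by (simp add: slice_empty_iff)
      then show ?thesis by simp
    qed
    then have "inj_on (\<lambda>z. restrict z (insert v T)) F"
      using inj_on_insert[OF ext T(1)] by blast
    moreover have "v \<notin> T" "finite T" using T fin[of T] by auto
    ultimately show ?thesis using T v by (auto simp: bases_def)
  qed
  have del: "T - {v} \<in> bases n (E - {v}) (slice E v (z v) F)"
    if "T \<in> bases (Suc n) E F" "v \<in> T" for T
  proof -
    have T: "T \<subseteq> E" "card T = Suc n" "inj_on (\<lambda>z. restrict z T) F"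
      using that by (auto simp: bases_def)
    have "insert v (T - {v}) = T" "T - {v} \<subseteq> E - {v}" using that T by auto
    with T inj_on_insert[OF ext, of "T - {v}" v] that show ?thesis
      by (auto simp: bases_def fin)
  qed
  show ?thesis
  proof (intro set_eqI iffI)
    fix T assume T: "T \<in> bases n (E - {v}) (slice E v (z v) F)"
    then have "T = insert v T - {v}" by (auto simp: bases_def)
    then show "T \<in> {T - {v} | T. T \<in> bases (Suc n) E F \<and> v \<in> T}" using ins[OF T] by blast
  next
    fix T assume "T \<in> {T - {v} | T. T \<in> bases (Suc n) E F \<and> v \<in> T}"
    then show "T \<in> bases n (E - {v}) (slice E v (z v) F)" using del by auto
  qed
qed

lemma insert_bases:
  assumes "G (Suc n) E F" "v \<in> E" "\<not> constant_at v F" "z \<in> F"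
    and "T \<in> bases n (E - {v}) (slice E v (z v) F)"
  shows "insert v T \<in> bases (Suc n) E F"
proof -
  from assms(5) obtain T' where "T' \<in> bases (Suc n) E F" "v \<in> T'" "T = T' - {v}"
    unfolding bases_slice[OF assms(1-4)] by blast
  then show ?thesis by (simp add: insert_absorb)
qed

text \<open>Two points that differ at a non-constant u must differ at some t in T. Slicing at this t
  lowers the rank and the size of T by one and keeps the rest of T injective.\<close>

lemma card_ge_if_inj:
  assumes "G n E F" "T \<subseteq> E" "inj_on (\<lambda>z. restrict z T) F"
  shows "n \<le> card T"
  using assms
proof (induction n arbitrary: E F T)
  case (Suc n)
  obtain u where u: "u \<in> E" "\<not> constant_at u F" using rank_Suc[OF Suc.prems(1)] by blast
  then obtain z w where zw: "z \<in> F" "w \<in> F" "z u \<noteq> w u" by (auto simp: constant_at_def)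
  then have "restrict z T \<noteq> restrict w T" using Suc.prems(3) by (metis inj_onD)
  then obtain t where t: "t \<in> T" "z t \<noteq> w t" by (auto simp: restrict_eq_iff)
  have "insert t (T - {t}) = T" "T - {t} \<subseteq> E - {t}" using t Suc.prems(2) by auto
  then have "inj_on (\<lambda>z. restrict z (T - {t})) (slice E t (z t) F)"
    using inj_on_insert[OF points_extensional[OF Suc.prems(1)]] Suc.prems(3) by metis
  moreover have "G n (E - {t}) (slice E t (z t) F)"
    using slice_Suc[OF Suc.prems(1)] t zw Suc.prems(2) by (auto simp: constant_at_def)
  ultimately have "n \<le> card (T - {t})" using Suc.IH \<open>T - {t} \<subseteq> E - {t}\<close> by blast
  moreover have "finite T" using finite_ground[OF Suc.prems(1)] Suc.prems(2) by (rule finite_subset[rotated])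
  ultimately show ?case using t(1) by (metis Suc_le_mono card.remove)
qed simp

text \<open>A constant coordinate could be dropped from T without loss of injectivity, which would
  leave fewer than n coordinates.\<close>

lemma basis_not_constant:
  assumes "G n E F" "T \<in> bases n E F" "t \<in> T"
  shows "\<not> constant_at t F"
proof
  assume const: "constant_at t F"
  have T: "T \<subseteq> E" "card T = n" "inj_on (\<lambda>z. restrict z T) F"
    using assms(2) by (auto simp: bases_def)
  have "inj_on (\<lambda>z. restrict z (T - {t})) F"
    using T(3) const unfolding inj_on_def restrict_eq_iff constant_at_def
    by (metis DiffI singletonD)
  then have "n \<le> card (T - {t})" using card_ge_if_inj[OF assms(1), of "T - {t}"] T(1) by blast
  moreover have "finite T" using finite_ground[OF assms(1)] T(1) by (rule finite_subset[rotated])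
  ultimately show False using card_Diff1_less[of T t] assms(3) T(2) by simp
qed

lemma bases_rank_0:
  assumes "G 0 E F"
  shows "bases 0 E F = {{}}"
proof -
  have "z = w" if "z \<in> F" "w \<in> F" for z w
    using rank_0[OF assms] that by (auto simp: constant_at_def)
  then have "inj_on (\<lambda>z. restrict z {}) F" by (auto simp: inj_on_def)
  moreover have "T = {}" if "T \<subseteq> E" "card T = 0" for T
    using finite_ground[OF assms] that by (metis card_0_eq finite_subset)
  ultimately show ?thesis by (auto simp: bases_def)
qed

lemma bases_nonempty: "G n E F \<Longrightarrow> bases n E F \<noteq> {}"
proof (induction n arbitrary: E F)
  case 0
  then show ?case by (simp add: bases_rank_0)
next
  case (Suc n)
  obtain v z where v: "v \<in> E" "\<not> constant_at v F" and z: "z \<in> F"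
    using rank_Suc[OF Suc.prems] nonempty[OF Suc.prems] by blast
  from Suc.IH[OF slice_Suc[OF Suc.prems v z]] insert_bases[OF Suc.prems v z] show ?case by blast
qed

lemma not_constant_in_basis:
  assumes "G n E F" "v \<in> E" "\<not> constant_at v F"
  shows "\<exists>T\<in>bases n E F. v \<in> T"
proof (cases n)
  case 0
  then show ?thesis using assms rank_0 by blast
next
  case (Suc n')
  note G = assms(1)[unfolded Suc]
  obtain z where z: "z \<in> F" using nonempty[OF G] by blast
  from bases_nonempty[OF slice_Suc[OF G assms(2,3) z]] insert_bases[OF G assms(2,3) z]
  show ?thesis unfolding Suc by blast
qed

text \<open>A basis for one rank is an injective set and therefore bounds the other rank from above.
  This is needed because the same slice may be a graph over different sets of coordinates.\<close>

lemma rank_unique: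
  assumes "G n E F" "G n' E F"
  shows "n = n'"
proof -
  have "k \<le> l" if G: "G l E F" "G k E F" for k l
  proof -
    obtain T where "T \<in> bases l E F" using bases_nonempty[OF G(1)] by blast
    then show ?thesis using card_ge_if_inj[OF G(2)] by (auto simp: bases_def)
  qed
  then show ?thesis using assms by (meson le_antisym)
qed

text \<open>If no basis contains both \<open>u\<close> and \<open>t\<close>, then the coordinate \<open>u\<close> is a function of the
  coordinate \<open>t\<close>, so \<open>t\<close> can replace \<open>u\<close> in every basis.\<close>

lemma bases_replace_parallel:
  assumes G: "G n E F" and U: "U \<in> bases n E F" "u \<in> U"
    and t: "t \<in> E" "\<not> constant_at t F" and par: "\<not> (\<exists>W\<in>bases n E F. u \<in> W \<and> t \<in> W)"
  shows "insert t (U - {u}) \<in> bases n E F"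
proof (cases n)
  case 0
  then show ?thesis using U bases_rank_0 G by auto
next
  case (Suc n')
  note G' = G[unfolded Suc]
  have UE: "U \<subseteq> E" "card U = Suc n'" "inj_on (\<lambda>z. restrict z U) F"
    using U Suc by (auto simp: bases_def)
  have ut: "u \<noteq> t" using not_constant_in_basis[OF G t] par by blast
  have tU: "t \<notin> U" using U par by blast
  have "z u = w u" if "z \<in> F" "w \<in> F" "z t = w t" for z w
  proof -
    let ?H = "slice E t (z t) F"
    have H: "G n' (E - {t}) ?H" using slice_Suc[OF G' t that(1)] .
    \<comment> \<open>Otherwise some basis of the slice at t contains u, and adding t gives a basis
      with both u and t.\<close>
    have "constant_at u ?H"
    proof (rule ccontr)
      assume "\<not> constant_at u ?H"
      then obtain T where "T \<in> bases n' (E - {t}) ?H" "u \<in> T"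
        using not_constant_in_basis[OF H] UE U(2) ut by blast
      then show False using insert_bases[OF G' t that(1)] par Suc by blast
    qed
    moreover have "restrict z (E - {t}) \<in> ?H" "restrict w (E - {t}) \<in> ?H"
      using that by (simp_all add: slice_def)
    ultimately have "restrict z (E - {t}) u = restrict w (E - {t}) u"
      unfolding constant_at_def by blast
    then show ?thesis using U(2) UE(1) ut by auto
  qed
  then have "inj_on (\<lambda>z. restrict z (insert t (U - {u}))) F"
    using UE(3) unfolding inj_on_def restrict_eq_iff by (metis DiffI insertCI singletonD)
  moreover have "finite U" using finite_ground[OF G] UE(1) by (rule finite_subset[rotated])
  then have "card (insert t (U - {u})) = card U"
    using tU U(2) card_Suc_Diff1[of U u] by simp
  ultimately show ?thesis using UE t(1) Suc by (auto simp: bases_def)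
qed

theorem matroid_bases:
  assumes "G n E F"
  shows "matroid_of_rank E (bases n E F) n"
  using assms
proof (induction n arbitrary: E F)
  case 0
  then show ?case
    using finite_ground[OF 0] by (auto simp: bases_rank_0 matroid_of_rank_def matroid_def)
next
  case (Suc n)
  note G = Suc.prems
  let ?m = "bases (Suc n) E F"
  obtain z where z: "z \<in> F" using nonempty[OF G] by blast
  have mE: "T \<subseteq> E" "card T = Suc n" if "T \<in> ?m" for T using that by (auto simp: bases_def)
  have nc: "\<not> constant_at u F" if "T \<in> ?m" "u \<in> T" for T u using basis_not_constant[OF G that] .
  let ?M = "\<lambda>u. bases n (E - {u}) (slice E u (z u) F)"
  have M: "matroid (E - {u}) (?M u)" if "u \<in> E" "\<not> constant_at u F" for u
    using Suc.IH[OF slice_Suc[OF G that z]] by (simp add: matroid_of_rank_def)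
  have common: "\<exists>w\<in>U - T. insert w (T - {v}) \<in> ?m"
    if "T \<in> ?m" "U \<in> ?m" "v \<in> T - U" "u \<in> T \<inter> U" for T U v u
  proof -
    have u: "u \<in> E" "\<not> constant_at u F" using that mE nc by blast+
    have "T - {u} \<in> ?M u" "U - {u} \<in> ?M u" using that by (auto simp: bases_slice[OF G u z])
    moreover have "v \<in> (T - {u}) - (U - {u})" using that by blast
    ultimately obtain w where w: "w \<in> (U - {u}) - (T - {u})" "insert w (T - {u} - {v}) \<in> ?M u"
      using M[OF u] unfolding matroid_def by blast
    have "insert u (insert w (T - {u} - {v})) = insert w (T - {v})" using that by blast
    then have "insert w (T - {v}) \<in> ?m" using insert_bases[OF G u z w(2)] by simp
    then show ?thesis using w by blast
  qed
  have augment: "\<exists>V\<in>?m. t \<in> V \<and> V \<subseteq> insert t U"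
    if "U \<in> ?m" "T \<in> ?m" "t \<in> T" for U T t
  proof -
    have t: "t \<in> E" "\<not> constant_at t F" using that mE nc by blast+
    have "U \<noteq> {}" using mE(2)[OF that(1)] by auto
    then obtain u where uU: "u \<in> U" by blast
    then have u: "u \<in> E" "\<not> constant_at u F" using that mE nc by blast+
    show ?thesis
    proof (cases "\<exists>W\<in>?m. u \<in> W \<and> t \<in> W \<and> t \<noteq> u")
      case True
      then obtain W where W: "W \<in> ?m" "u \<in> W" "t \<in> W" "t \<noteq> u" by blast
      then have "W - {u} \<in> ?M u" "U - {u} \<in> ?M u" "{t} \<subseteq> W - {u}"
        using that(1) uU by (auto simp: bases_slice[OF G u z])
      \<comment> \<open>Inside the slice at u, where the induction hypothesis provides a matroid,
        {t} is independent because of W and is completed from U - {u}.\<close>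
      from matroid_basis_between[OF M[OF u] this] obtain V
        where "V \<in> ?M u" "{t} \<subseteq> V" "V \<subseteq> {t} \<union> (U - {u})" by blast
      then show ?thesis using insert_bases[OF G u z] uU by blast
    next
      case False
      show ?thesis
      proof (cases "t = u")
        case True
        then show ?thesis using uU that by blast
      next
        case False
        then have "insert t (U - {u}) \<in> ?m"
          using bases_replace_parallel[OF G that(1) uU t] \<open>\<not> (\<exists>W\<in>?m. _ W)\<close> by blast
        then show ?thesis by blast
      qed
    qed
  qed
  have exchange: "\<exists>w\<in>U - T. insert w (T - {v}) \<in> ?m"
    if TU: "T \<in> ?m" "U \<in> ?m" "v \<in> T - U" for T U v
  proof (cases "T - {v} = {}")
    \<comment> \<open>The rank is 1 here, and the exchange turns T into U.\<close>
    case True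
    have "T = {v}" using True TU(3) by blast
    then have "card U = 1" using mE(2)[OF TU(1)] mE(2)[OF TU(2)] by simp
    then obtain w where "U = {w}" by (auto simp: card_1_singleton_iff)
    then show ?thesis using TU(2,3) \<open>T = {v}\<close> by auto
  next
    case False
    then obtain t where t: "t \<in> T" "t \<noteq> v" by blast
    obtain V where V: "V \<in> ?m" "t \<in> V" "V \<subseteq> insert t U" using augment[OF TU(2,1) t(1)] by blast
    \<comment> \<open>The element that \<open>common\<close> selects from V - T differs from t,
      since t is in T; by the choice of V it therefore lies in U.\<close>
    have "v \<in> T - V" using TU(3) V(3) t(2) by blast
    from common[OF TU(1) V(1) this] t(1) V(2,3) show ?thesis by blast
  qed
  then have "matroid E ?m"
    unfolding matroid_def using finite_ground[OF G] bases_nonempty[OF G] mE(1) by blast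
  then show ?case using mE(2) by (auto simp: matroid_of_rank_def)
qed

text \<open>The coordinates of I are fixed one after another. After slicing at v, the set T - {v} is
  a basis of the slice and contains the rest of I, so no later coordinate is constant and each one
  costs exactly one in the rank.\<close>

lemma slice_independent:
  assumes "G n E F" "T \<in> bases n E F" "I \<subseteq> T" "{z \<in> F. \<forall>v\<in>I. z v = c v} \<noteq> {}"
  shows "G (n - card I) (E - I) ((\<lambda>z. restrict z (E - I)) ` {z \<in> F. \<forall>v\<in>I. z v = c v}) \<and>
    bases (n - card I) (E - I) ((\<lambda>z. restrict z (E - I)) ` {z \<in> F. \<forall>v\<in>I. z v = c v})
      = {T - I | T. T \<in> bases n E F \<and> I \<subseteq> T}"
proof -
  have "finite I"
    using assms(2,3) by (auto simp: bases_def intro: finite_subset[OF _ finite_ground[OF assms(1)]])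
  then show ?thesis using assms
  proof (induction I arbitrary: n E F T)
    case empty
    have "(\<lambda>z. restrict z E) ` F = F"
      using points_extensional[OF empty.prems(1)] by (simp add: extensional_restrict subset_iff)
    moreover have "{z \<in> F. \<forall>v\<in>{}. z v = c v} = F" by simp
    ultimately show ?case
      using empty.prems(1) by (simp only: Diff_empty card.empty diff_zero empty_subsetI) simp
  next
    case (insert v I)
    have v: "v \<in> E" "\<not> constant_at v F" and n: "n \<noteq> 0"
      using insert.prems(2,3) basis_not_constant[OF insert.prems(1,2), of v]
        rank_0[of E F v] insert.prems(1)
      by (auto simp: bases_def intro: gr0I)
    obtain n' where n': "n = Suc n'" using n not0_implies_Suc by blast
    note G = insert.prems(1)[unfolded n']
    \<comment> \<open>A point of the full intersection shows that the first slice and the remaining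
      intersection in it are non-empty.\<close>
    obtain z where z: "z \<in> F" "z v = c v" "\<forall>i\<in>I. z i = c i" using insert.prems(4) by auto
    let ?H = "slice E v (z v) F"
    have IE: "I \<subseteq> E - {v}" using insert.prems(2,3) insert.hyps by (auto simp: bases_def)
    have H: "G n' (E - {v}) ?H" using slice_Suc[OF G v z(1)] .
    have bH: "bases n' (E - {v}) ?H = {T - {v} | T. T \<in> bases n E F \<and> v \<in> T}"
      using bases_slice[OF G v z(1)] n' by simp
    have sH: "{x \<in> ?H. \<forall>i\<in>I. x i = c i} =
        (\<lambda>x. restrict x (E - {v})) ` {x \<in> F. \<forall>i\<in>insert v I. x i = c i}" (is "?L = ?R")
    proof -
      have "{x \<in> ?H. \<forall>i\<in>I. x i = c i} =
          (\<lambda>x. restrict x (E - {v})) ` {x \<in> {x \<in> F. x v = z v}. \<forall>i\<in>I. restrict x (E - {v}) i = c i}"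
        unfolding slice_def by blast
      also have "{x \<in> {x \<in> F. x v = z v}. \<forall>i\<in>I. restrict x (E - {v}) i = c i} =
          {x \<in> F. \<forall>i\<in>insert v I. x i = c i}"
        using IE z(2) by (auto simp: subset_iff)
      finally show ?thesis .
    qed
    have TI: "T - {v} \<in> bases n' (E - {v}) ?H" "I \<subseteq> T - {v}"
      using bH insert.prems(2,3) insert.hyps(2) by auto
    have ne: "?L \<noteq> {}" unfolding sH using z by auto
    have Eq: "E - {v} - I = E - insert v I" "n' - card I = n - card (insert v I)"
      using insert.hyps n' by auto
    have im: "(\<lambda>x. restrict x (E - {v} - I)) ` ?L =
        (\<lambda>x. restrict x (E - insert v I)) ` {x \<in> F. \<forall>i\<in>insert v I. x i = c i}"
    proof -
      have "restrict (restrict x (E - {v})) (E - insert v I) = restrict x (E - insert v I)"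
        for x :: "'v \<Rightarrow> 'a" by (auto simp: fun_eq_iff)
      then show ?thesis unfolding sH image_image Eq by simp
    qed
    have bs: "{T - I | T. T \<in> bases n' (E - {v}) ?H \<and> I \<subseteq> T} =
        {T - insert v I | T. T \<in> bases n E F \<and> insert v I \<subseteq> T}" (is "?P = ?Q")
    proof
      show "?P \<subseteq> ?Q" unfolding bH by auto
      show "?Q \<subseteq> ?P"
      proof
        fix S assume "S \<in> ?Q"
        then obtain T where T: "S = T - insert v I" "T \<in> bases n E F" "insert v I \<subseteq> T" by blast
        then have "S = (T - {v}) - I" "I \<subseteq> T - {v}" "T - {v} \<in> bases n' (E - {v}) ?H"
          unfolding bH using insert.hyps(2) by auto
        then show "S \<in> ?P" by blast
      qed
    qed
    from insert.IH[OF H TI ne] show ?case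
      unfolding im unfolding bs unfolding Eq .
  qed
qed

text \<open>Since both values occur at t, this coordinate is not constant. The slice at a t has rank
  one less and still realises every pattern on T - {t}. The corners of a box supply such patterns in
  the dimension bound.\<close>

lemma card_le_if_shattered:
  assumes "G n E F" "T \<subseteq> E" "\<And>i. i \<in> T \<Longrightarrow> a i \<noteq> b i"
    and "\<And>w. (\<And>i. i \<in> T \<Longrightarrow> w i \<in> {a i, b i}) \<Longrightarrow> \<exists>z\<in>F. \<forall>i\<in>T. z i = w i"
  shows "card T \<le> n"
  using assms
proof (induction n arbitrary: E F T)
  case (0 E F T)
  have "T = {}"
  proof (rule ccontr)
    assume "T \<noteq> {}"
    then obtain t where t: "t \<in> T" by blast
    obtain z where "z \<in> F" "z t = a t" using 0(4)[of a] t by auto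
    moreover obtain w where "w \<in> F" "w t = b t" using 0(4)[of b] t by auto
    ultimately show False using rank_0[OF 0(1), of t] 0(3)[OF t] by (metis constant_at_def)
  qed
  then show ?case by simp
next
  case (Suc n E F T)
  show ?case
  proof (cases "T = {}")
    case False
    then obtain t where t: "t \<in> T" by blast
    obtain z where z: "z \<in> F" "z t = a t" using Suc.prems(4)[of a] t by auto
    obtain w where w: "w \<in> F" "w t = b t" using Suc.prems(4)[of b] t by auto
    have nc: "\<not> constant_at t F" using z w Suc.prems(3)[OF t] by (metis constant_at_def)
    have H: "G n (E - {t}) (slice E t (z t) F)"
      using slice_Suc[OF Suc.prems(1) _ nc z(1)] t Suc.prems(2) by blast
    have "\<exists>x\<in>slice E t (z t) F. \<forall>i\<in>T - {t}. x i = w i"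
      if w: "\<And>i. i \<in> T - {t} \<Longrightarrow> w i \<in> {a i, b i}" for w
    proof -
      have "(w(t := a t)) i \<in> {a i, b i}" if "i \<in> T" for i
        using w[of i] that by (cases "i = t") auto
      then obtain x where x: "x \<in> F" "\<forall>i\<in>T. x i = (w(t := a t)) i" using Suc.prems(4) by blast
      then have "restrict x (E - {t}) \<in> slice E t (z t) F" using t z by (auto simp: slice_def)
      moreover have "\<forall>i\<in>T - {t}. restrict x (E - {t}) i = w i" using x Suc.prems(2) by auto
      ultimately show ?thesis by blast
    qed
    then have "card (T - {t}) \<le> n"
      using Suc.IH[OF H, of "T - {t}"] Suc.prems(2,3) by blast
    then show ?thesis by (simp add: card_Diff_singleton t)
  qed simp
qed

end

section \<open>Definable sets\<close>

lemma topspace_powertop_real: "topspace (powertop_real I) = extensional I"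
  by (auto simp: PiE_def)

locale o_minimal =
  fixes S :: "nat \<Rightarrow> real list set set"
  assumes o_minimal: "o_minimal_structure S"
begin

lemma
  shows length_definable: "A \<in> S n \<Longrightarrow> xs \<in> A \<Longrightarrow> length xs = n"
    and definable_empty: "{} \<in> S n"
    and definable_Compl: "A \<in> S n \<Longrightarrow> {xs. length xs = n} - A \<in> S n"
    and definable_Un: "A \<in> S n \<Longrightarrow> B \<in> S n \<Longrightarrow> A \<union> B \<in> S n"
    and definable_diagonal_less: "i < j \<Longrightarrow> j < n \<Longrightarrow> {xs. length xs = n \<and> xs ! i = xs ! j} \<in> S n"
    and definable_Cons: "A \<in> S n \<Longrightarrow> {x # xs | x xs. xs \<in> A} \<in> S (Suc n)"
    and definable_butlast: "A \<in> S (Suc n) \<Longrightarrow> butlast ` A \<in> S n"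
    and definable_plus_graph: "{[x, y, x + y] | x y. True} \<in> S 3"
    and definable_line: "S 1 = {(\<lambda>x. [x]) ` \<Union>J | J. finite J \<and> (\<forall>T\<in>J. is_interval T)}"
proof -
  note o = o_minimal[unfolded o_minimal_structure_def]
  have 1: "\<forall>n. \<forall>A\<in>S n. A \<subseteq> {xs. length xs = n}" using o by (elim conjE)
  have 2: "\<forall>n. {} \<in> S n" using o by (elim conjE)
  have 3: "\<forall>n. \<forall>A\<in>S n. {xs. length xs = n} - A \<in> S n" using o by (elim conjE)
  have 4: "\<forall>n. \<forall>A\<in>S n. \<forall>B\<in>S n. A \<union> B \<in> S n" using o by (elim conjE)
  have 5: "\<forall>n i j. i < j \<and> j < n \<longrightarrow> {xs. length xs = n \<and> xs ! i = xs ! j} \<in> S n" using o by (elim conjE)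
  have 6: "\<forall>n. \<forall>A\<in>S n. {x # xs | x xs. xs \<in> A} \<in> S (Suc n) \<and> {xs @ [x] | x xs. xs \<in> A} \<in> S (Suc n)" using o by (elim conjE)
  have 7: "\<forall>n. \<forall>A\<in>S (Suc n). butlast ` A \<in> S n" using o by (elim conjE)
  have 8: "{[x, y, x + y] | x y. True} \<in> S 3" using o by (elim conjE)
  have 9: "S 1 = {(\<lambda>x. [x]) ` \<Union>J | J. finite J \<and> (\<forall>T\<in>J. is_interval T)}" using o by (elim conjE)
  show "A \<in> S n \<Longrightarrow> xs \<in> A \<Longrightarrow> length xs = n" using 1 by blast
  show "{} \<in> S n" using 2 ..
  show "A \<in> S n \<Longrightarrow> {xs. length xs = n} - A \<in> S n" using 3 by simp
  show "A \<in> S n \<Longrightarrow> B \<in> S n \<Longrightarrow> A \<union> B \<in> S n" using 4 by simp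
  show "i < j \<Longrightarrow> j < n \<Longrightarrow> {xs. length xs = n \<and> xs ! i = xs ! j} \<in> S n" using 5 by simp
  show "A \<in> S n \<Longrightarrow> {x # xs | x xs. xs \<in> A} \<in> S (Suc n)" by (rule 6[rule_format, THEN conjunct1])
  show "A \<in> S (Suc n) \<Longrightarrow> butlast ` A \<in> S n" using 7 by simp
  show "{[x, y, x + y] | x y. True} \<in> S 3" by (rule 8)
  show "S 1 = {(\<lambda>x. [x]) ` \<Union>J | J. finite J \<and> (\<forall>T\<in>J. is_interval T)}" by (rule 9)
qed

section \<open>Closure of the definable families under intersection and substitution of
  coordinates\<close>

lemma definable_full: "{xs. length xs = n} \<in> S n"
  using definable_Compl[OF definable_empty] by simp

lemma definable_Int:
  assumes "A \<in> S n" "B \<in> S n"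
  shows "A \<inter> B \<in> S n"
proof -
  let ?U = "{xs. length xs = n}"
  have "A \<inter> B = ?U - ((?U - A) \<union> (?U - B))"
    using assms length_definable by auto
  then show ?thesis using assms by (metis definable_Compl definable_Un)
qed

lemma definable_diagonal:
  assumes "i < n" "j < n"
  shows "{xs. length xs = n \<and> xs ! i = xs ! j} \<in> S n"
proof -
  consider "i < j" | "j < i" | "i = j" by linarith
  then show ?thesis
  proof cases
    case 1
    then show ?thesis using definable_diagonal_less assms by simp
  next
    case 2
    then show ?thesis using definable_diagonal_less[of j i n] assms by (simp add: eq_commute)
  next
    case 3
    then show ?thesis using definable_full by simp
  qed
qed

lemma definable_diagonals:
  fixes p q :: "nat \<Rightarrow> nat"
  assumes "\<And>i. i < m \<Longrightarrow> p i < n \<and> q i < n"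
  shows "{xs. length xs = n \<and> (\<forall>i<m. xs ! p i = xs ! q i)} \<in> S n"
  using assms
proof (induction m)
  case 0
  then show ?case using definable_full by simp
next
  case (Suc m)
  have eq: "{xs. length xs = n \<and> (\<forall>i<Suc m. xs ! p i = xs ! q i)} =
      {xs. length xs = n \<and> (\<forall>i<m. xs ! p i = xs ! q i)} \<inter> {xs. length xs = n \<and> xs ! p m = xs ! q m}"
    by (auto simp: less_Suc_eq)
  show ?case
    unfolding eq by (intro definable_Int definable_diagonal Suc.IH) (use Suc.prems in auto)
qed

lemma definable_prepend:
  assumes "A \<in> S n"
  shows "{ys @ xs | ys xs. length ys = m \<and> xs \<in> A} \<in> S (m + n)"
proof (induction m)
  case 0
  then show ?case using assms by simp
next
  case (Suc m)
  let ?B = "{ys @ xs | ys xs. length ys = m \<and> xs \<in> A}"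
  have "{x # xs | x xs. xs \<in> ?B} = {ys @ xs | ys xs. length ys = Suc m \<and> xs \<in> A}" (is "?L = ?R")
  proof
    show "?L \<subseteq> ?R"
    proof
      fix zs assume "zs \<in> ?L"
      then obtain x ys xs where "zs = (x # ys) @ xs" "length (x # ys) = Suc m" "xs \<in> A" by auto
      then show "zs \<in> ?R" by blast
    qed
    show "?R \<subseteq> ?L"
    proof
      fix zs assume "zs \<in> ?R"
      then obtain x ys xs where "zs = x # (ys @ xs)" "length ys = m" "xs \<in> A"
        by (auto simp: length_Suc_conv)
      then show "zs \<in> ?L" by blast
    qed
  qed
  moreover have "{x # xs | x xs. xs \<in> ?B} \<in> S (Suc (m + n))"
    using Suc by (rule definable_Cons)
  ultimately show ?case by simp
qed

lemma definable_take: "A \<in> S (n + m) \<Longrightarrow> take n ` A \<in> S n"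
proof (induction m arbitrary: A)
  case 0
  then have "take n ` A = A" using length_definable[of A n] by (force simp: image_iff)
  then show ?case using 0 by simp
next
  case (Suc m)
  have "butlast ` A \<in> S (n + m)"
    using Suc.prems by (simp add: definable_butlast)
  then have "take n ` butlast ` A \<in> S n" by (rule Suc.IH)
  moreover have "take n (butlast xs) = take n xs" if "xs \<in> A" for xs
    using length_definable[OF Suc.prems that] by (simp add: take_butlast)
  then have "take n ` butlast ` A = take n ` A" by (force simp: image_image)
  ultimately show ?case by simp
qed

text \<open>A copy ys of the selected coordinates is appended to xs, tied to them by diagonals,
  restricted to A and projected away. Repetitions in \<sigma> are allowed.\<close>

lemma definable_preimage:
  assumes A: "A \<in> S (length \<sigma>)" and \<sigma>: "set \<sigma> \<subseteq> {..<n}"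
  shows "{xs. length xs = n \<and> map ((!) xs) \<sigma> \<in> A} \<in> S n"
proof -
  let ?m = "length \<sigma>"
  let ?P = "{xs @ ys | xs ys. length xs = n \<and> ys \<in> A}"
  let ?D = "{zs. length zs = n + ?m \<and> (\<forall>i<?m. zs ! (n + i) = zs ! (\<sigma> ! i))}"
  have "?D \<in> S (n + ?m)"
  proof (rule definable_diagonals)
    fix i assume "i < ?m"
    then have "\<sigma> ! i \<in> {..<n}" using \<sigma> nth_mem by blast
    then show "n + i < n + ?m \<and> \<sigma> ! i < n + ?m" using \<open>i < ?m\<close> by auto
  qed
  then have "take n ` (?P \<inter> ?D) \<in> S n"
    using definable_prepend[OF A] by (intro definable_take definable_Int)
  also have "take n ` (?P \<inter> ?D) = {xs. length xs = n \<and> map ((!) xs) \<sigma> \<in> A}"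
  proof -
    have eq: "(\<forall>i<?m. (xs @ ys) ! (n + i) = (xs @ ys) ! (\<sigma> ! i)) \<longleftrightarrow> ys = map ((!) xs) \<sigma>"
      if xs: "length xs = n" and ys: "length ys = ?m" for xs ys
    proof -
      have "(xs @ ys) ! (n + i) = ys ! i" "(xs @ ys) ! (\<sigma> ! i) = xs ! (\<sigma> ! i)" if "i < ?m" for i
        using \<sigma> xs nth_mem[OF that] by (auto simp: nth_append)
      then show ?thesis using ys by (auto simp: list_eq_iff_nth_eq)
    qed
    show ?thesis
    proof (intro set_eqI iffI)
      fix xs assume "xs \<in> take n ` (?P \<inter> ?D)"
      then obtain ys where "length xs = n" "ys \<in> A" "xs @ ys \<in> ?D" by auto
      then show "xs \<in> {xs. length xs = n \<and> map ((!) xs) \<sigma> \<in> A}"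
        using eq[of xs ys] length_definable[OF A] by auto
    next
      fix xs assume xs: "xs \<in> {xs. length xs = n \<and> map ((!) xs) \<sigma> \<in> A}"
      let ?ys = "map ((!) xs) \<sigma>"
      have "\<forall>i<?m. (xs @ ?ys) ! (n + i) = (xs @ ?ys) ! (\<sigma> ! i)"
        using eq[of xs ?ys] xs by simp
      then have "xs @ ?ys \<in> ?P \<inter> ?D" using xs by auto
      moreover have "take n (xs @ ?ys) = xs" using xs by simp
      ultimately show "xs \<in> take n ` (?P \<inter> ?D)" by (intro image_eqI[of _ _ "xs @ ?ys"]) (simp_all only:)
    qed
  qed
  finally show ?thesis .
qed

text \<open>Same construction with the blocks in the opposite order: projections forget trailing
  coordinates, so the image has to stand in front.\<close>

lemma definable_image:
  assumes A: "A \<in> S n" and \<sigma>: "set \<sigma> \<subseteq> {..<n}"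
  shows "(\<lambda>xs. map ((!) xs) \<sigma>) ` A \<in> S (length \<sigma>)"
proof -
  let ?m = "length \<sigma>"
  let ?P = "{ys @ xs | ys xs. length ys = ?m \<and> xs \<in> A}"
  let ?D = "{zs. length zs = ?m + n \<and> (\<forall>i<?m. zs ! i = zs ! (?m + \<sigma> ! i))}"
  have "?D \<in> S (?m + n)"
  proof (rule definable_diagonals)
    fix i assume "i < ?m"
    then have "\<sigma> ! i \<in> {..<n}" using \<sigma> nth_mem by blast
    then show "i < ?m + n \<and> ?m + \<sigma> ! i < ?m + n" using \<open>i < ?m\<close> by auto
  qed
  then have "take ?m ` (?P \<inter> ?D) \<in> S ?m"
    using definable_prepend[OF A] by (intro definable_take definable_Int)
  also have "take ?m ` (?P \<inter> ?D) = (\<lambda>xs. map ((!) xs) \<sigma>) ` A"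
  proof -
    have eq: "(\<forall>i<?m. (ys @ xs) ! i = (ys @ xs) ! (?m + \<sigma> ! i)) \<longleftrightarrow> ys = map ((!) xs) \<sigma>"
      if "length ys = ?m" for xs ys
      using that by (auto simp: list_eq_iff_nth_eq nth_append)
    show ?thesis
    proof (intro set_eqI iffI)
      fix ys assume "ys \<in> take ?m ` (?P \<inter> ?D)"
      then obtain xs where "length ys = ?m" "xs \<in> A" "ys @ xs \<in> ?D" by auto
      then show "ys \<in> (\<lambda>xs. map ((!) xs) \<sigma>) ` A"
        using eq[of ys xs] by auto
    next
      fix ys assume "ys \<in> (\<lambda>xs. map ((!) xs) \<sigma>) ` A"
      then obtain xs where xs: "xs \<in> A" "ys = map ((!) xs) \<sigma>" by blast
      then have "\<forall>i<?m. (ys @ xs) ! i = (ys @ xs) ! (?m + \<sigma> ! i)" "length ys = ?m"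
        using eq[of ys xs] by auto
      then have "ys @ xs \<in> ?P" "ys @ xs \<in> ?D"
        using xs(1) length_definable[OF A xs(1)] by (blast, simp)
      then have "ys @ xs \<in> ?P \<inter> ?D" by (rule IntI)
      moreover have "take ?m (ys @ xs) = ys" using xs by simp
      ultimately show "ys \<in> take ?m ` (?P \<inter> ?D)" by (intro image_eqI[of _ _ "ys @ xs"]) (simp_all only:)
    qed
  qed
  finally show ?thesis .
qed

lemma definable_nth_interval:
  assumes "is_interval T" "i < n"
  shows "{xs. length xs = n \<and> xs ! i \<in> T} \<in> S n"
proof -
  have "(\<lambda>x. [x]) ` \<Union>{T} \<in> S 1"
    unfolding definable_line using assms(1) by blast
  then have "{xs. length xs = n \<and> map ((!) xs) [i] \<in> (\<lambda>x. [x]) ` T} \<in> S n"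
    using assms(2) by (intro definable_preimage) auto
  also have "{xs. length xs = n \<and> map ((!) xs) [i] \<in> (\<lambda>x. [x]) ` T} = {xs. length xs = n \<and> xs ! i \<in> T}"
    by auto
  finally show ?thesis .
qed

lemma definable_uminus_graph: "{[x, - x] | x. True} \<in> S 2"
proof -
  have "(\<lambda>xs. map ((!) xs) [0, 1]) `
      ({[x, y, x + y] | x y. True} \<inter> {xs. length xs = 3 \<and> xs ! 2 \<in> {0}}) \<in> S (length [0, 1::nat])"
    by (intro definable_image[of _ 3] definable_Int definable_nth_interval definable_plus_graph)
      (auto simp: is_interval_1)
  also have "(\<lambda>xs. map ((!) xs) [0, 1]) `
      ({[x, y, x + y] | x y. True} \<inter> {xs. length xs = 3 \<and> xs ! 2 \<in> {0}}) = {[x, - x] | x :: real. True}"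
    (is "?L = ?R")
  proof
    show "?L \<subseteq> ?R" by auto
    show "?R \<subseteq> ?L"
    proof
      fix zs :: "real list" assume "zs \<in> ?R"
      then obtain x where "zs = [x, - x]" by blast
      then show "zs \<in> ?L" by (intro image_eqI[of _ _ "[x, - x, x + - x]"]) auto
    qed
  qed
  finally show ?thesis by (simp add: numeral_2_eq_2)
qed

section \<open>Definability in the span of a set of labels\<close>

lemma definable_set_map:
  assumes Z: "definable_set S E Z" and ws: "set ws \<subseteq> E"
  shows "(\<lambda>z. map z ws) ` Z \<in> S (length ws)"
proof -
  obtain vs where vs: "set vs = E" "(\<lambda>z. map z vs) ` Z \<in> S (length vs)"
    using Z by (auto simp: definable_set_def)
  have "\<forall>w\<in>E. \<exists>i<length vs. vs ! i = w" using vs(1) by (metis in_set_conv_nth)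
  \<comment> \<open>\<open>p w\<close> is a position of the label w in the enumeration
    \<open>vs\<close>; reading off the labels \<open>ws\<close> thus becomes a selection of
    positions, for any list \<open>ws\<close> over E.\<close>
  then obtain p where p: "\<And>w. w \<in> E \<Longrightarrow> p w < length vs \<and> vs ! p w = w" by metis
  have "(\<lambda>xs. map ((!) xs) (map p ws)) ` (\<lambda>z. map z vs) ` Z \<in> S (length (map p ws))"
    using p ws by (intro definable_image[OF vs(2)]) auto
  moreover have "map ((!) (map z vs)) (map p ws) = map z ws" for z :: "'a \<Rightarrow> real"
    using p ws by auto
  ultimately show ?thesis by (simp add: image_image del: map_map)
qed

lemma definable_setI:
  assumes "finite E" "Z \<subseteq> extensional E"
    and "\<And>vs. distinct vs \<Longrightarrow> set vs = E \<Longrightarrow> (\<lambda>z. map z vs) ` Z \<in> S (length vs)"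
  shows "definable_set S E Z"
  using assms finite_distinct_list[OF assms(1)]
  unfolding definable_set_def topspace_powertop_real by blast

lemma definable_set_restrict:
  assumes Z: "definable_set S E Z" and T: "T \<subseteq> E" "finite T"
  shows "definable_set S T ((\<lambda>z. restrict z T) ` Z)"
proof (rule definable_setI[OF T(2)])
  fix vs assume vs: "distinct vs" "set vs = T"
  have "(\<lambda>z. map z vs) ` (\<lambda>z. restrict z T) ` Z = (\<lambda>z. map z vs) ` Z"
    unfolding image_image using vs by (intro image_cong) auto
  then show "(\<lambda>z. map z vs) ` (\<lambda>z. restrict z T) ` Z \<in> S (length vs)"
    using definable_set_map[OF Z] vs T by simp
qed auto

lemma definable_set_interval:
  assumes Z: "definable_set S E Z" and v: "v \<in> E" and K: "is_interval K"
  shows "definable_set S E {z \<in> Z. z v \<in> K}"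
proof -
  obtain vs where vs: "distinct vs" "set vs = E" "(\<lambda>z. map z vs) ` Z \<in> S (length vs)"
    using Z by (auto simp: definable_set_def)
  obtain i where i: "i < length vs" "vs ! i = v" using v vs(2) by (metis in_set_conv_nth)
  have "(\<lambda>z. map z vs) ` {z \<in> Z. z v \<in> K} =
      (\<lambda>z. map z vs) ` Z \<inter> {xs. length xs = length vs \<and> xs ! i \<in> K}"
    using i by auto
  also have "\<dots> \<in> S (length vs)"
    using i by (intro definable_Int vs(3) definable_nth_interval K)
  finally show ?thesis
    using Z vs unfolding definable_set_def by blast
qed

lemma definable_set_slice:
  assumes "definable_set S E Z" "v \<in> E" "finite E"
  shows "definable_set S (E - {v}) (slice E v c Z)"
proof -
  have "definable_set S E {z \<in> Z. z v \<in> {c}}"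
    by (rule definable_set_interval) (use assms in \<open>auto simp: is_interval_1\<close>)
  then show ?thesis unfolding slice_def using assms(3)
    by (auto intro: definable_set_restrict)
qed

text \<open>The point is cut out by one degenerate interval for each coordinate. This serves the
  slices of rank 0.\<close>

lemma definable_set_singleton:
  assumes "finite E" "z \<in> extensional E"
  shows "definable_set S E {z}"
proof (rule definable_setI[OF assms(1)])
  fix vs assume vs: "set vs = E"
  have "{xs. length xs = length vs \<and> (\<forall>i<k. xs ! i = z (vs ! i))} \<in> S (length vs)"
    if "k \<le> length vs" for k
    using that
  proof (induction k)
    case 0
    then show ?case using definable_full by simp
  next
    case (Suc k)
    have "{xs. length xs = length vs \<and> (\<forall>i<Suc k. xs ! i = z (vs ! i))} =
      {xs. length xs = length vs \<and> (\<forall>i<k. xs ! i = z (vs ! i))} \<inter>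
      {xs. length xs = length vs \<and> xs ! k \<in> {z (vs ! k)}}"
      by (auto simp: less_Suc_eq)
    then show ?case using Suc by (auto intro!: definable_Int definable_nth_interval[of "{_}", simplified] simp: is_interval_1)
  qed
  from this[of "length vs"]
  have "{xs. length xs = length vs \<and> (\<forall>i<length vs. xs ! i = z (vs ! i))} \<in> S (length vs)" by simp
  also have "{xs. length xs = length vs \<and> (\<forall>i<length vs. xs ! i = z (vs ! i))} = {map z vs}"
    by (auto simp: list_eq_iff_nth_eq)
  finally show "(\<lambda>z. map z vs) ` {z} \<in> S (length vs)" by simp
qed (use assms in auto)

lemma definable_fun_uminus:
  assumes "definable_fun S A X h"
  shows "definable_fun S A X (\<lambda>x. - h x)"
proof -
  obtain vs where vs: "distinct vs" "set vs = A" "(\<lambda>x. map x vs @ [h x]) ` X \<in> S (Suc (length vs))"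
    using assms by (auto simp: definable_fun_def)
  let ?n = "length vs"
  let ?H = "(\<lambda>x. map x vs @ [h x]) ` X"
  \<comment> \<open>Position \<open>?n\<close> holds the negated value and position
    \<open>Suc ?n\<close> the value of h, so that \<open>take (Suc ?n)\<close> forgets the latter.
    The list \<open>?s\<close> skips position \<open>?n\<close>.\<close>
  let ?s = "[0..<?n] @ [Suc ?n]"
  let ?P = "{xs. length xs = Suc ?n + 1 \<and> map ((!) xs) ?s \<in> ?H}"
  let ?Q = "{xs. length xs = Suc ?n + 1 \<and> map ((!) xs) [Suc ?n, ?n] \<in> {[x, - x] | x. True}}"
  have "?P \<in> S (Suc ?n + 1)"
    by (rule definable_preimage) (use vs(3) in auto)
  moreover have "?Q \<in> S (Suc ?n + 1)"
    by (rule definable_preimage) (use definable_uminus_graph in \<open>auto simp: numeral_2_eq_2\<close>)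
  ultimately have "take (Suc ?n) ` (?P \<inter> ?Q) \<in> S (Suc ?n)"
    by (intro definable_take definable_Int)
  also have "take (Suc ?n) ` (?P \<inter> ?Q) = (\<lambda>x. map x vs @ [- h x]) ` X" (is "?L = ?R")
  proof
    have nth: "map ((!) (xs @ [a, b])) ?s = xs @ [b]" "map ((!) (xs @ [a, b])) [Suc ?n, ?n] = [b, a]"
      if "length xs = ?n" for xs and a b :: real
      using that by (auto simp: nth_append intro!: nth_equalityI)
    show "?L \<subseteq> ?R"
    proof
      fix ys assume "ys \<in> ?L"
      then obtain zs where zs: "zs \<in> ?P" "zs \<in> ?Q" "ys = take (Suc ?n) zs"
        by (elim imageE IntE)
      then have "length zs = Suc (Suc ?n)" by simp
      then obtain xs a b where eq: "zs = xs @ [a, b]" "length xs = ?n"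
        by (auto simp: length_Suc_conv_rev)
      from zs(1) obtain x where x: "x \<in> X" "xs = map x vs" "b = h x"
        unfolding mem_Collect_eq eq(1) nth[OF eq(2)] by auto
      from zs(2) have "a = - b"
        unfolding mem_Collect_eq eq(1) nth[OF eq(2)] by auto
      then show "ys \<in> ?R" using x zs(3) eq by auto
    qed
    show "?R \<subseteq> ?L"
    proof
      fix ys assume "ys \<in> ?R"
      then obtain x where x: "x \<in> X" "ys = map x vs @ [- h x]" by blast
      let ?z = "map x vs @ [- h x, h x]"
      have "?z \<in> ?P" "?z \<in> ?Q"
        unfolding mem_Collect_eq using x nth[of "map x vs"] by auto
      moreover have "ys = take (Suc ?n) ?z" using x by simp
      ultimately show "ys \<in> ?L" by (intro image_eqI IntI)
    qed
  qed
  finally show ?thesis using assms vs(1,2) unfolding definable_fun_def by blast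
qed

lemma definable_fun_less:
  assumes "definable_fun S A X h"
  shows "definable_set S A {x \<in> X. h x < b}"
proof -
  obtain vs where vs: "distinct vs" "set vs = A" "(\<lambda>x. map x vs @ [h x]) ` X \<in> S (Suc (length vs))"
    using assms by (auto simp: definable_fun_def)
  let ?n = "length vs"
  have "take ?n ` ((\<lambda>x. map x vs @ [h x]) ` X \<inter> {xs. length xs = ?n + 1 \<and> xs ! ?n \<in> {..<b}}) \<in> S ?n"
    using vs(3) by (intro definable_take[of _ _ 1] definable_Int definable_nth_interval) auto
  also have "take ?n ` ((\<lambda>x. map x vs @ [h x]) ` X \<inter> {xs. length xs = ?n + 1 \<and> xs ! ?n \<in> {..<b}}) =
      (\<lambda>x. map x vs) ` {x \<in> X. h x < b}" (is "?L = ?R")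
  proof
    show "?L \<subseteq> ?R" by (auto simp: nth_append)
    show "?R \<subseteq> ?L"
    proof
      fix ys assume "ys \<in> ?R"
      then obtain x where x: "x \<in> X" "h x < b" "ys = map x vs" by blast
      then show "ys \<in> ?L" by (intro image_eqI[of _ _ "map x vs @ [h x]"]) (auto simp: nth_append)
    qed
  qed
  finally show ?thesis using assms vs(1,2) unfolding definable_fun_def definable_set_def by auto
qed

text \<open>Definability is assumed for the graph of the whole map; forgetting the other range
  coordinates leaves the graph of one component.\<close>

lemma definable_component:
  assumes G: "definable_set S (A \<union> B) (map_graph A B X f)"
    and "finite A" "A \<inter> B = {}" "X \<subseteq> extensional A" "i \<in> B"
  shows "definable_fun S A X (\<lambda>x. f x i)"
proof -
  obtain vs where vs: "distinct vs" "set vs = A" using finite_distinct_list[OF assms(2)] by blast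
  have "(\<lambda>z. map z (vs @ [i])) ` map_graph A B X f \<in> S (length (vs @ [i]))"
    by (rule definable_set_map[OF G]) (use vs assms in auto)
  also have "(\<lambda>z. map z (vs @ [i])) ` map_graph A B X f = (\<lambda>x. map x vs @ [f x i]) ` X"
    unfolding map_graph_def image_image using vs assms
    by (intro image_cong) (auto simp: merge_def)
  finally show ?thesis
    using vs assms(4) unfolding definable_fun_def topspace_powertop_real by auto
qed

end

section \<open>Topology of coordinate spaces\<close>

definition open_box :: "'v set \<Rightarrow> ('v \<Rightarrow> real) \<Rightarrow> real \<Rightarrow> ('v \<Rightarrow> real) set" where
  "open_box A x e = (\<Pi>\<^sub>E i\<in>A. {x i - e<..<x i + e})"

lemma mem_open_box: "y \<in> open_box A x e \<longleftrightarrow> y \<in> extensional A \<and> (\<forall>i\<in>A. \<bar>y i - x i\<bar> < e)"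
proof -
  have "(y i \<in> {x i - e<..<x i + e}) = (\<bar>y i - x i\<bar> < e)" for i
    by (auto simp: abs_less_iff)
  then show ?thesis unfolding open_box_def PiE_iff by blast
qed

lemma openin_open_box: "finite A \<Longrightarrow> openin (powertop_real A) (open_box A x e)"
  unfolding open_box_def openin_PiE_gen by auto

lemma openin_contains_open_box:
  assumes U: "openin (powertop_real A) U" and x: "x \<in> U" and A: "finite A"
  shows "\<exists>e>0. open_box A x e \<subseteq> U"
proof -
  obtain V where "\<forall>i\<in>A. openin euclideanreal (V i)" and V': "x \<in> Pi\<^sub>E A V" "Pi\<^sub>E A V \<subseteq> U"
    using bspec[OF U[unfolded openin_product_topology_alt] x] by (elim exE conjE)
  then have V: "\<And>i. i \<in> A \<Longrightarrow> open (V i)" by simp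
  have "\<forall>i\<in>A. \<exists>e>0. \<forall>y. \<bar>y - x i\<bar> < e \<longrightarrow> y \<in> V i"
  proof
    fix i assume "i \<in> A"
    then show "\<exists>e>0. \<forall>y. \<bar>y - x i\<bar> < e \<longrightarrow> y \<in> V i"
      using V[OF \<open>i \<in> A\<close>] V'(1) unfolding open_dist dist_real_def by (auto simp: PiE_iff)
  qed
  then obtain d where d: "\<And>i. i \<in> A \<Longrightarrow> d i > 0" "\<And>i y. i \<in> A \<Longrightarrow> \<bar>y - x i\<bar> < d i \<Longrightarrow> y \<in> V i"
    by metis
  \<comment> \<open>The 1 keeps the minimum meaningful when A is empty.\<close>
  define e where "e = Min (insert 1 (d ` A))"
  have "e > 0" unfolding e_def using A d(1) by auto
  have ed: "e \<le> d i" if "i \<in> A" for i unfolding e_def using A that by auto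
  have "open_box A x e \<subseteq> Pi\<^sub>E A V"
  proof
    fix y assume y: "y \<in> open_box A x e"
    then have "y i \<in> V i" if "i \<in> A" for i
      using d(2)[OF that, of "y i"] ed[OF that] that unfolding mem_open_box by auto
    then show "y \<in> Pi\<^sub>E A V" using y unfolding mem_open_box PiE_iff by blast
  qed
  then show ?thesis using V'(2) \<open>e > 0\<close> by blast
qed

lemma openin_move_coordinate:
  assumes U: "openin (powertop_real A) U" and x: "x \<in> U" and A: "finite A" and l: "l \<in> A"
  shows "\<exists>y\<in>U. y l \<noteq> x l \<and> (\<forall>k\<in>A - {l}. y k = x k)"
proof -
  obtain e where e: "e > 0" "open_box A x e \<subseteq> U"
    using openin_contains_open_box[OF assms(1-3)] by blast
  have "x \<in> extensional A"
    using U x openin_subset topspace_powertop_real by blast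
  then have "x(l := x l + e / 2) \<in> open_box A x e"
    unfolding mem_open_box using e l by (auto simp: extensional_def)
  then show ?thesis using e by (intro bexI[of _ "x(l := x l + e / 2)"]) auto
qed

text \<open>\<open>independent_of\<close> only compares points with x j < y j; the reverse order
  follows by symmetry, and with equal values at j the points coincide.\<close>

lemma independent_of_eq:
  assumes "independent_of A X h j" "X \<subseteq> extensional A" "x \<in> X" "y \<in> X" "\<forall>k\<in>A - {j}. x k = y k"
  shows "h x = h y"
proof -
  consider "j \<in> A" "x j < y j" | "j \<in> A" "y j < x j" | "j \<notin> A \<or> x j = y j" by linarith
  then show ?thesis
  proof cases
    case 1
    then show ?thesis using assms unfolding independent_of_def by blast
  next
    case 2
    moreover have "\<forall>k\<in>A - {j}. y k = x k" using assms(5) by simp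
    ultimately have "h y = h x" using assms(1,3,4) unfolding independent_of_def by blast
    then show ?thesis by simp
  next
    case 3
    then have "x = y" using assms(2-5) by (intro extensionalityI[of x A y]) auto
    then show ?thesis by simp
  qed
qed

text \<open>Inside a box, one point is moved to another by changing one coordinate at a time, so h
  is locally constant. Its level sets and their complements in X are then open, and connectedness
  leaves only one level.\<close>

lemma constant_if_independent:
  assumes X: "openin (powertop_real A) X" "connectedin (powertop_real A) X" and A: "finite A"
    and ind: "\<And>j. j \<in> A \<Longrightarrow> independent_of A X h j" and xy: "x \<in> X" "y \<in> X"
  shows "h x = h y"
proof -
  have ext: "X \<subseteq> extensional A" using openin_subset[OF X(1)] by (simp only: topspace_powertop_real)
  have local: "\<exists>e>0. open_box A z e \<subseteq> X \<and> (\<forall>w\<in>open_box A z e. h w = h z)" if z: "z \<in> X" for z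
  proof -
    obtain e where e: "e > 0" "open_box A z e \<subseteq> X"
      using openin_contains_open_box[OF X(1) z A] by blast
    have "h w = h z" if w: "w \<in> open_box A z e" for w
    proof -
      \<comment> \<open>Hybrids of w and z stay in the box because a box is a product; this may fail
        in X itself.\<close>
      have mix: "(\<lambda>i. if i \<in> T then w i else z i) \<in> X" if "T \<subseteq> A" for T
      proof -
        have "(\<lambda>i. if i \<in> T then w i else z i) \<in> open_box A z e"
          using w z ext that e(1) unfolding mem_open_box by (auto simp: extensional_def subset_iff)
        then show ?thesis using e(2) by blast
      qed
      have "h (\<lambda>i. if i \<in> T then w i else z i) = h z" if "finite T" "T \<subseteq> A" for T
        using that
      proof (induction T)
        case (insert t T)
        have "h (\<lambda>i. if i \<in> insert t T then w i else z i) = h (\<lambda>i. if i \<in> T then w i else z i)"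
          by (rule independent_of_eq[OF ind[of t] ext]) (use insert mix[of T] mix[of "insert t T"] in auto)
        then show ?case using insert by simp
      qed simp
      from this[OF A order_refl] have "h (\<lambda>i. if i \<in> A then w i else z i) = h z" .
      moreover have "(\<lambda>i. if i \<in> A then w i else z i) = w"
        using w z ext unfolding mem_open_box by (auto simp: extensional_def fun_eq_iff)
      ultimately show ?thesis by simp
    qed
    then show ?thesis using e by blast
  qed
  have op: "openin (powertop_real A) {z \<in> X. P (h z)}" for P
  proof (subst openin_subopen, intro ballI)
    fix z assume z: "z \<in> {z \<in> X. P (h z)}"
    then obtain e where e: "e > 0" "open_box A z e \<subseteq> X" "\<forall>w\<in>open_box A z e. h w = h z"
      using local by blast
    have "z \<in> open_box A z e" using z ext e(1) unfolding mem_open_box by auto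
    moreover have "open_box A z e \<subseteq> {z \<in> X. P (h z)}" using e z by auto
    ultimately show "\<exists>T. openin (powertop_real A) T \<and> z \<in> T \<and> T \<subseteq> {z \<in> X. P (h z)}"
      using openin_open_box[OF A] by blast
  qed
  show ?thesis
  proof (rule ccontr)
    assume "h x \<noteq> h y"
    show False
    proof (rule connectedinD[OF X(2) op[of "\<lambda>r. r = h x"] op[of "\<lambda>r. r \<noteq> h x"]])
      show "{z \<in> X. h z = h x} \<inter> X \<noteq> {}" "{z \<in> X. h z \<noteq> h x} \<inter> X \<noteq> {}"
        using xy \<open>h x \<noteq> h y\<close> by auto
    qed auto
  qed
qed

text \<open>Seen as the preimage under the continuous map that inserts the value c at j, a slice of
  an open set is open.\<close>

lemma slice_eq_preimage:
  assumes "j \<in> A" "X \<subseteq> extensional A"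
  shows "slice A j c X = {y \<in> extensional (A - {j}). y(j := c) \<in> X}"
proof -
  have eq: "(restrict x (A - {j}))(j := c) = x" if "x \<in> X" "x j = c" for x
    using that assms by (auto simp: fun_eq_iff extensional_def)
  show ?thesis
  proof (intro set_eqI iffI)
    fix y assume "y \<in> slice A j c X"
    then obtain x where "x \<in> X" "x j = c" "y = restrict x (A - {j})" by (auto simp: slice_def)
    then show "y \<in> {y \<in> extensional (A - {j}). y(j := c) \<in> X}" using eq by simp
  next
    fix y assume y: "y \<in> {y \<in> extensional (A - {j}). y(j := c) \<in> X}"
    then have "restrict (y(j := c)) (A - {j}) = y" by (auto simp: fun_eq_iff extensional_def)
    then show "y \<in> slice A j c X" using y unfolding slice_def
      by (intro image_eqI[of _ _ "y(j := c)"]) auto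
  qed
qed

lemma continuous_map_insert_coordinate:
  assumes "j \<in> A"
  shows "continuous_map (powertop_real (A - {j})) (powertop_real A) (\<lambda>y. y(j := c))"
  unfolding continuous_map_componentwise
proof (intro conjI ballI)
  show "(\<lambda>y. y(j := c)) ` topspace (powertop_real (A - {j})) \<subseteq> extensional A"
    unfolding topspace_powertop_real using assms by (auto simp: extensional_def)
  fix k assume "k \<in> A"
  then show "continuous_map (powertop_real (A - {j})) euclideanreal (\<lambda>y. (y(j := c)) k)"
    by (cases "k = j") (auto intro: continuous_map_product_projection)
qed

lemma continuous_map_restrict_coordinates:
  assumes "T \<subseteq> A"
  shows "continuous_map (powertop_real A) (powertop_real T) (\<lambda>z. restrict z T)"
  unfolding continuous_map_componentwise
proof (intro conjI ballI)
  fix k assume k: "k \<in> T"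
  then have "continuous_map (powertop_real A) euclideanreal (\<lambda>z. z k)"
    using assms by (intro continuous_map_product_projection) auto
  then show "continuous_map (powertop_real A) euclideanreal (\<lambda>z. restrict z T k)"
    using k by simp
qed auto

lemma openin_slice:
  assumes X: "openin (powertop_real A) X" and j: "j \<in> A"
  shows "openin (powertop_real (A - {j})) (slice A j c X)"
proof -
  have ext: "X \<subseteq> extensional A" using openin_subset[OF X] by (simp only: topspace_powertop_real)
  show ?thesis
    using openin_continuous_map_preimage[OF continuous_map_insert_coordinate[OF j] X]
    unfolding slice_eq_preimage[OF j ext] topspace_powertop_real .
qed

subsection \<open>The line\<close>

text \<open>On the line this is connectedness in a form that is visibly stable under intersection,
  as needed for the intersections with cones.\<close>

definition order_convex_on :: "'v \<Rightarrow> ('v \<Rightarrow> real) set \<Rightarrow> bool" where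
  "order_convex_on l Z \<longleftrightarrow>
     (\<forall>x\<in>Z. \<forall>y\<in>Z. \<forall>z\<in>extensional {l}. x l \<le> z l \<and> z l \<le> y l \<longrightarrow> z \<in> Z)"

abbreviation line_point :: "'v \<Rightarrow> real \<Rightarrow> 'v \<Rightarrow> real" where
  "line_point l t \<equiv> (\<lambda>i\<in>{l}. t)"

lemma line_point_eq: "z \<in> extensional {l} \<Longrightarrow> line_point l (z l) = z"
  by (auto simp: fun_eq_iff extensional_def)

lemma continuous_map_line_point: "continuous_map euclideanreal (powertop_real {l}) (line_point l)"
  unfolding continuous_map_componentwise by auto

lemma order_convex_on_iff_connectedin:
  assumes Z: "Z \<subseteq> extensional {l}"
  shows "order_convex_on l Z \<longleftrightarrow> connectedin (powertop_real {l}) Z"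
proof
  assume conv: "order_convex_on l Z"
  have "is_interval ((\<lambda>z. z l) ` Z)"
    unfolding is_interval_1
  proof (intro ballI allI impI)
    fix a b t assume "a \<in> (\<lambda>z. z l) ` Z" "b \<in> (\<lambda>z. z l) ` Z" "a \<le> t \<and> t \<le> b"
    then have "line_point l t \<in> Z" using conv unfolding order_convex_on_def by auto
    then show "t \<in> (\<lambda>z. z l) ` Z"
      by (intro image_eqI[of _ _ "line_point l t"]) auto
  qed
  then have "connectedin (powertop_real {l}) (line_point l ` (\<lambda>z. z l) ` Z)"
    by (intro connectedin_continuous_map_image[OF continuous_map_line_point])
      (simp add: is_interval_connected_1)
  moreover have "line_point l ` (\<lambda>z. z l) ` Z = Z"
  proof -
    have "(\<lambda>z. line_point l (z l)) ` Z = (\<lambda>z. z) ` Z"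
      by (rule image_cong[OF refl], rule line_point_eq) (use Z in blast)
    then show ?thesis unfolding image_image image_ident .
  qed
  ultimately show "connectedin (powertop_real {l}) Z" by simp
next
  assume con: "connectedin (powertop_real {l}) Z"
  have "connectedin euclideanreal ((\<lambda>z. z l) ` Z)"
    by (rule connectedin_continuous_map_image[OF continuous_map_product_projection con]) simp
  then have int: "is_interval ((\<lambda>z. z l) ` Z)"
    by (simp add: is_interval_connected_1)
  show "order_convex_on l Z" unfolding order_convex_on_def
  proof (intro ballI impI)
    fix x y z assume "x \<in> Z" "y \<in> Z" "z \<in> extensional {l}" "x l \<le> z l \<and> z l \<le> y l"
    then have "z l \<in> (\<lambda>z. z l) ` Z" using int unfolding is_interval_1 by blast
    then obtain w where "w \<in> Z" "z l = w l" by auto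
    then have "z = w" using Z \<open>z \<in> extensional {l}\<close>
      by (intro extensionalityI[of z "{l}" w]) auto
    then show "z \<in> Z" using \<open>w \<in> Z\<close> by simp
  qed
qed

lemma order_convex_coordinate_cone:
  assumes "coordinate_cone {l} C"
  shows "order_convex_on l C"
proof -
  obtain J \<sigma> c where J: "J \<subseteq> {l}" "\<forall>j\<in>J. \<sigma> j \<in> {(<), (=), (>)}"
      "C = {z \<in> topspace (powertop_real {l}). \<forall>j\<in>J. \<sigma> j (z j) (c j :: real)}"
    using assms unfolding coordinate_cone_def by blast
  have C: "C = {z \<in> extensional {l}. \<forall>j\<in>J. \<sigma> j (z j) (c j)}"
    using J(3) unfolding topspace_powertop_real .
  show ?thesis
  proof (cases "J = {}")
    case True
    then show ?thesis unfolding C order_convex_on_def by simp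
  next
    case False
    then have "J = {l}" using J(1) by blast
    then show ?thesis using J(2) unfolding C order_convex_on_def by auto
  qed
qed

lemma order_convex_on_Int: "order_convex_on l Y \<Longrightarrow> order_convex_on l Z \<Longrightarrow> order_convex_on l (Y \<inter> Z)"
  unfolding order_convex_on_def by blast

section \<open>Semi-monotone sets, and monotone functions of one variable\<close>

lemma semi_monotone_connected:
  assumes "semi_monotone S A X"
  shows "connectedin (powertop_real A) X"
proof -
  \<comment> \<open>The cone given by no conditions is the whole space.\<close>
  have "coordinate_cone A (topspace (powertop_real A))"
    unfolding coordinate_cone_def by (rule exI[of _ "{}"]) simp
  then have "connectedin (powertop_real A) (X \<inter> topspace (powertop_real A))"
    using assms unfolding semi_monotone_def by blast
  moreover have "X \<subseteq> topspace (powertop_real A)"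
    using assms unfolding semi_monotone_def by (blast dest: openin_subset)
  ultimately show ?thesis by (simp only: Int_absorb2)
qed

lemma semi_monotone_extensional:
  assumes "semi_monotone S A X"
  shows "X \<subseteq> extensional A"
  using assms openin_subset topspace_powertop_real unfolding semi_monotone_def by blast

lemma bounded_in_subset: "bounded_in I Z \<Longrightarrow> Y \<subseteq> Z \<Longrightarrow> bounded_in I Y"
  unfolding bounded_in_def by blast

context o_minimal
begin

text \<open>A cone in the span of A - {j} becomes a cone in the span of A by adding the condition z
  j = c. Its intersection with X is connected, and projecting away j maps it onto the required
  intersection with the slice.\<close>

lemma semi_monotone_slice:
  assumes X: "semi_monotone S A X" and A: "finite A" and j: "j \<in> A"
  shows "semi_monotone S (A - {j}) (slice A j c X)"
  unfolding semi_monotone_def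
proof (intro conjI allI impI)
  note ext = semi_monotone_extensional[OF X]
  show "openin (powertop_real (A - {j})) (slice A j c X)"
    using X j unfolding semi_monotone_def by (intro openin_slice) auto
  show "bounded_in (A - {j}) (slice A j c X)"
    using X unfolding semi_monotone_def bounded_in_def slice_def by fastforce
  show "definable_set S (A - {j}) (slice A j c X)"
    using X A j unfolding semi_monotone_def by (intro definable_set_slice) auto
  fix C assume "coordinate_cone (A - {j}) C"
  then obtain J \<sigma> b where J: "J \<subseteq> A - {j}" "\<forall>k\<in>J. \<sigma> k \<in> {(<), (=), (>)}"
      and C: "C = {z \<in> topspace (powertop_real (A - {j})). \<forall>k\<in>J. \<sigma> k (z k) (b k :: real)}"
    unfolding coordinate_cone_def by blast
  let ?\<sigma> = "\<sigma>(j := (=))" and ?b = "b(j := c)"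
  let ?C = "{z \<in> topspace (powertop_real A). \<forall>k\<in>insert j J. ?\<sigma> k (z k) (?b k)}"
  have J': "insert j J \<subseteq> A" "\<forall>k\<in>insert j J. ?\<sigma> k \<in> {(<), (=), (>)}" using J j by auto
  have "coordinate_cone A ?C"
    unfolding coordinate_cone_def
    by (rule exI[of _ "insert j J"], rule exI[of _ ?\<sigma>], rule exI[of _ ?b]) (use J' in simp)
  then have "connectedin (powertop_real A) (X \<inter> ?C)"
    using X unfolding semi_monotone_def by blast
  then have "connectedin (powertop_real (A - {j})) ((\<lambda>z. restrict z (A - {j})) ` (X \<inter> ?C))"
    by (rule connectedin_continuous_map_image[OF continuous_map_restrict_coordinates, rotated]) auto
  also have "(\<lambda>z. restrict z (A - {j})) ` (X \<inter> ?C) = slice A j c X \<inter> C"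
  proof -
    have "z \<in> ?C \<longleftrightarrow> z j = c \<and> restrict z (A - {j}) \<in> C" if "z \<in> X" for z
    proof -
      have "z \<in> ?C \<longleftrightarrow> (\<forall>k\<in>insert j J. ?\<sigma> k (z k) (?b k))"
        using that ext unfolding topspace_powertop_real by blast
      moreover have "(\<forall>k\<in>J. ?\<sigma> k (z k) (?b k)) \<longleftrightarrow> (\<forall>k\<in>J. \<sigma> k (restrict z (A - {j}) k) (b k))"
        by (rule ball_cong) (use J(1) in auto)
      ultimately show ?thesis unfolding C topspace_powertop_real by simp
    qed
    then have "X \<inter> ?C = {z \<in> X. z j = c \<and> restrict z (A - {j}) \<in> C}" by blast
    then show ?thesis
      unfolding slice_def by blast
  qed
  finally show "connectedin (powertop_real (A - {j})) (slice A j c X \<inter> C)" .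
qed

text \<open>Sublevel sets of a weakly monotone function on an interval are order convex, and so are
  the cones of the line; hence they meet in connected sets.\<close>

lemma submonotone_line:
  assumes Y: "semi_monotone S {l} Y" "Y \<noteq> {}"
    and h: "continuous_map (subtopology (powertop_real {l}) Y) euclideanreal h"
      "bounded (h ` Y)" "definable_fun S {l} Y h"
    and mono: "(\<forall>x\<in>Y. \<forall>y\<in>Y. x l \<le> y l \<longrightarrow> h x \<le> h y) \<or> (\<forall>x\<in>Y. \<forall>y\<in>Y. x l \<le> y l \<longrightarrow> h y \<le> h x)"
  shows "submonotone S {l} Y h"
proof -
  note ext = semi_monotone_extensional[OF Y(1)]
  have opY: "openin (powertop_real {l}) Y" using Y(1) unfolding semi_monotone_def by blast
  have tY: "topspace (subtopology (powertop_real {l}) Y) = Y"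
    using ext unfolding topspace_subtopology topspace_powertop_real by blast
  have conv: "order_convex_on l Y"
    using order_convex_on_iff_connectedin[OF ext] semi_monotone_connected[OF Y(1)] by blast
  have usc: "openin (subtopology (powertop_real {l}) Y) {x \<in> Y. h x < b}" for b
  proof -
    have "openin (subtopology (powertop_real {l}) Y)
        {x \<in> topspace (subtopology (powertop_real {l}) Y). h x \<in> {..<b}}"
      by (rule openin_continuous_map_preimage[OF h(1)]) simp
    then show ?thesis unfolding tY by simp
  qed
  have lev: "semi_monotone S {l} {x \<in> Y. h x < b}" for b
    unfolding semi_monotone_def
  proof (intro conjI allI impI)
    show "openin (powertop_real {l}) {x \<in> Y. h x < b}"
      using usc opY openin_trans_full by blast
    show "bounded_in {l} {x \<in> Y. h x < b}"
      using Y(1) unfolding semi_monotone_def by (auto intro: bounded_in_subset)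
    show "definable_set S {l} {x \<in> Y. h x < b}" by (rule definable_fun_less[OF h(3)])
    fix C assume C: "coordinate_cone {l} C"
    have "order_convex_on l {x \<in> Y. h x < b}"
      unfolding order_convex_on_def
    proof (intro ballI impI)
      fix x y z assume *: "x \<in> {x \<in> Y. h x < b}" "y \<in> {x \<in> Y. h x < b}" "z \<in> extensional {l}"
        "x l \<le> z l \<and> z l \<le> y l"
      then have z: "z \<in> Y" using conv unfolding order_convex_on_def by blast
      then have "h z \<le> h x \<or> h z \<le> h y" using mono * by blast
      then show "z \<in> {x \<in> Y. h x < b}" using z * by auto
    qed
    then have "order_convex_on l ({x \<in> Y. h x < b} \<inter> C)"
      using order_convex_coordinate_cone[OF C] by (rule order_convex_on_Int)
    moreover have sub: "{x \<in> Y. h x < b} \<inter> C \<subseteq> extensional {l}" using ext by blast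
    ultimately show "connectedin (powertop_real {l}) ({x \<in> Y. h x < b} \<inter> C)"
      unfolding order_convex_on_iff_connectedin[OF sub] by simp
  qed
  show ?thesis
    unfolding submonotone_def upper_semicontinuous_def
    by (intro conjI allI Y h usc lev)
qed

text \<open>A continuous injective function on an interval is strictly monotone. Injective or
  constant is exactly what is known of the components of a slice with one-dimensional
  domain.\<close>

lemma monotone_function_line:
  assumes Y: "semi_monotone S {l} Y" "Y \<noteq> {}"
    and h: "continuous_map (subtopology (powertop_real {l}) Y) euclideanreal h"
      "bounded (h ` Y)" "definable_fun S {l} Y h"
    and inj: "inj_on h Y \<or> (\<forall>x\<in>Y. \<forall>y\<in>Y. h x = h y)"
  shows "monotone_function S {l} Y h"
proof -
  note ext = semi_monotone_extensional[OF Y(1)]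
  have cases: "(\<forall>x\<in>Y. \<forall>y\<in>Y. x l < y l \<longrightarrow> h x < h y) \<or> (\<forall>x\<in>Y. \<forall>y\<in>Y. x l < y l \<longrightarrow> h y < h x) \<or>
      (\<forall>x\<in>Y. \<forall>y\<in>Y. h x = h y)"
  proof (cases "\<forall>x\<in>Y. \<forall>y\<in>Y. h x = h y")
    case False
    then have inj: "inj_on h Y" using inj by blast
    let ?K = "(\<lambda>z. z l) ` Y" and ?h = "h \<circ> line_point l"
    have lp: "line_point l (z l) = z" if "z \<in> Y" for z
      by (rule line_point_eq) (use that ext in blast)
    have "connectedin euclideanreal ?K"
      by (rule connectedin_continuous_map_image[OF continuous_map_product_projection
            semi_monotone_connected[OF Y(1)]]) simp
    then have K: "is_interval ?K" by (simp add: is_interval_connected_1)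
    have "continuous_map (top_of_set ?K) (subtopology (powertop_real {l}) Y) (line_point l)"
      using lp by (auto intro!: continuous_map_into_subtopology
          continuous_map_from_subtopology[OF continuous_map_line_point])
    then have "continuous_map (top_of_set ?K) euclideanreal ?h"
      using h(1) by (rule continuous_map_compose)
    then have "continuous_on ?K ?h" by simp
    moreover have "inj_on ?h ?K"
      using inj lp by (auto simp: inj_on_def)
    ultimately have "strict_mono_on ?K ?h \<or> strict_antimono_on ?K ?h"
      using injective_eq_monotone_map[OF K] by blast
    then show ?thesis
    proof
      assume m: "strict_mono_on ?K ?h"
      have "h x < h y" if "x \<in> Y" "y \<in> Y" "x l < y l" for x y
        using monotone_onD[OF m, of "x l" "y l"] that lp by simp
      then show ?thesis by blast
    next
      assume m: "strict_antimono_on ?K ?h"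
      have "h y < h x" if "x \<in> Y" "y \<in> Y" "x l < y l" for x y
        using monotone_onD[OF m, of "x l" "y l"] that lp by simp
      then show ?thesis by blast
    qed
  qed blast
  have eq: "x = y" if "x \<in> Y" "y \<in> Y" "x l = y l" for x y
    using that ext by (intro extensionalityI[of x "{l}" y]) auto
  have mono: "(\<forall>x\<in>Y. \<forall>y\<in>Y. x l \<le> y l \<longrightarrow> h x \<le> h y) \<or> (\<forall>x\<in>Y. \<forall>y\<in>Y. x l \<le> y l \<longrightarrow> h y \<le> h x)"
    using cases
  proof (elim disjE)
    assume c: "\<forall>x\<in>Y. \<forall>y\<in>Y. x l < y l \<longrightarrow> h x < h y"
    have "h x \<le> h y" if "x \<in> Y" "y \<in> Y" "x l \<le> y l" for x y
      using c eq[OF that(1,2)] that by (cases "x l = y l") (auto intro: less_imp_le)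
    then show ?thesis by blast
  next
    assume c: "\<forall>x\<in>Y. \<forall>y\<in>Y. x l < y l \<longrightarrow> h y < h x"
    have "h y \<le> h x" if "x \<in> Y" "y \<in> Y" "x l \<le> y l" for x y
      using c eq[OF that(1,2)] that by (cases "x l = y l") (auto intro: less_imp_le)
    then show ?thesis by blast
  next
    assume c: "\<forall>x\<in>Y. \<forall>y\<in>Y. h x = h y"
    then have "h x \<le> h y" if "x \<in> Y" "y \<in> Y" for x y using that by (intro eq_refl) blast
    then show ?thesis by blast
  qed
  have "submonotone S {l} Y h"
    using submonotone_line[OF Y h mono] .
  moreover have "submonotone S {l} Y (\<lambda>x. - h x)"
  proof (rule submonotone_line[OF Y])
    show "continuous_map (subtopology (powertop_real {l}) Y) euclideanreal (\<lambda>x. - h x)"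
      using h(1) by (rule continuous_map_minus)
    show "bounded ((\<lambda>x. - h x) ` Y)"
      using h(2) unfolding bounded_iff by simp
    show "definable_fun S {l} Y (\<lambda>x. - h x)"
      by (rule definable_fun_uminus[OF h(3)])
    \<comment> \<open>Negation interchanges the increasing and the decreasing alternative.\<close>
    show "(\<forall>x\<in>Y. \<forall>y\<in>Y. x l \<le> y l \<longrightarrow> - h x \<le> - h y) \<or> (\<forall>x\<in>Y. \<forall>y\<in>Y. x l \<le> y l \<longrightarrow> - h y \<le> - h x)"
      unfolding neg_le_iff_le by (subst disj_commute) (rule mono)
  qed
  moreover have "strictly_increasing_in {l} Y h l \<or> strictly_decreasing_in {l} Y h l \<or> independent_of {l} Y h l"
    using cases unfolding strictly_increasing_in_def strictly_decreasing_in_def independent_of_def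
    by blast
  ultimately show ?thesis
    unfolding monotone_function_def supermonotone_def by simp
qed

end

section \<open>Graphs\<close>

lemma slice_slice:
  assumes "j \<in> E - {i}"
  shows "slice (E - {i}) j c (slice E i b F) =
    (\<lambda>z. restrict z (E - {i, j})) ` {z \<in> F. z i = b \<and> z j = c}"
proof -
  have "{w \<in> (\<lambda>z. restrict z (E - {i})) ` {z \<in> F. z i = b}. w j = c} =
      (\<lambda>z. restrict z (E - {i})) ` {z \<in> {z \<in> F. z i = b}. restrict z (E - {i}) j = c}"
    by blast
  also have "{z \<in> {z \<in> F. z i = b}. restrict z (E - {i}) j = c} = {z \<in> F. z i = b \<and> z j = c}"
    using assms by auto
  finally have *: "{w \<in> (\<lambda>z. restrict z (E - {i})) ` {z \<in> F. z i = b}. w j = c} =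
      (\<lambda>z. restrict z (E - {i})) ` {z \<in> F. z i = b \<and> z j = c}" .
  have r: "restrict (restrict z (E - {i})) (E - {i} - {j}) = restrict z (E - {i, j})" for z :: "'a \<Rightarrow> 'b"
    by (auto simp: fun_eq_iff)
  show ?thesis unfolding slice_def * image_image r ..
qed

lemma slice_commute:
  assumes "i \<in> E" "j \<in> E" "i \<noteq> j"
  shows "slice (E - {i}) j c (slice E i b F) = slice (E - {j}) i b (slice E j c F)"
proof -
  have "{z \<in> F. z i = b \<and> z j = c} = {z \<in> F. z j = c \<and> z i = b}" by blast
  then show ?thesis using assms by (simp add: slice_slice insert_commute)
qed

lemma map_graph_extensional: "map_graph A B X f \<subseteq> extensional (A \<union> B)"
  by (auto simp: map_graph_def merge_def extensional_def)

lemma inj_on_merge: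
  assumes "X \<subseteq> extensional A"
  shows "inj_on (\<lambda>x. merge A B (x, f x)) X"
proof (rule inj_onI)
  fix x y assume *: "x \<in> X" "y \<in> X" "merge A B (x, f x) = merge A B (y, f y)"
  have "x k = y k" if "k \<in> A" for k
    using fun_cong[OF *(3), of k] that by (simp add: merge_def)
  then show "x = y" using * assms by (intro extensionalityI[of x A y]) auto
qed

lemma map_graph_eqI:
  assumes "z \<in> map_graph A B X f" "w \<in> map_graph A B X f" "X \<subseteq> extensional A" "\<forall>k\<in>A. z k = w k"
  shows "z = w"
proof -
  obtain x y where x: "x \<in> X" "z = merge A B (x, f x)" and y: "y \<in> X" "w = merge A B (y, f y)"
    using assms(1,2) by (auto simp: map_graph_def)
  have "x k = y k" if "k \<in> A" for k
    using assms(4) that unfolding x(2) y(2) by (auto simp: merge_def)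
  then have "x = y" using x y assms(3) by (intro extensionalityI[of x A y]) auto
  then show ?thesis using x y by simp
qed

text \<open>As x is recovered from (x, f x), injectivity on X and on the graph are the same. The
  splitting into A and B then enters only through their union and the number
  \<open>card A\<close>.\<close>

lemma basis_sets_eq_bases:
  assumes "X \<subseteq> extensional A"
  shows "basis_sets A B X f = bases (card A) (A \<union> B) (map_graph A B X f)"
proof -
  have "inj_on (\<lambda>x. restrict (merge A B (x, f x)) T) X \<longleftrightarrow> inj_on (\<lambda>z. restrict z T) (map_graph A B X f)" for T
    unfolding map_graph_def comp_inj_on_iff[OF inj_on_merge[OF assms]] by (simp add: comp_def)
  then show ?thesis unfolding basis_sets_def bases_def by simp
qed

lemma slice_map_graph:
  assumes j: "j \<in> A" "A \<inter> B = {}" and X: "X \<subseteq> extensional A"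
  shows "slice (A \<union> B) j c (map_graph A B X f) =
    map_graph (A - {j}) B (slice A j c X) (\<lambda>y. f (y(j := c)))"
proof -
  have "{z \<in> map_graph A B X f. z j = c} = (\<lambda>x. merge A B (x, f x)) ` {x \<in> X. x j = c}"
    using j by (auto simp: map_graph_def merge_def)
  then have "slice (A \<union> B) j c (map_graph A B X f) =
      (\<lambda>x. restrict (merge A B (x, f x)) (A \<union> B - {j})) ` {x \<in> X. x j = c}"
    unfolding slice_def by (simp only: image_image)
  also have "\<dots> = (\<lambda>x. merge (A - {j}) B (restrict x (A - {j}), f ((restrict x (A - {j}))(j := c)))) ` {x \<in> X. x j = c}"
  proof (rule image_cong[OF refl])
    fix x assume x: "x \<in> {x \<in> X. x j = c}"
    then have eq: "(restrict x (A - {j}))(j := c) = x"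
      using X j by (auto simp: fun_eq_iff extensional_def)
    show "restrict (merge A B (x, f x)) (A \<union> B - {j}) =
        merge (A - {j}) B (restrict x (A - {j}), f ((restrict x (A - {j}))(j := c)))"
      unfolding eq using j by (auto simp: fun_eq_iff merge_def)
  qed
  also have "\<dots> = map_graph (A - {j}) B (slice A j c X) (\<lambda>y. f (y(j := c)))"
    unfolding map_graph_def slice_def image_image ..
  finally show ?thesis .
qed

lemma slice_empty_map_graph:
  assumes "j \<in> A"
  shows "slice (A \<union> B) j c (map_graph A B X f) = {} \<longleftrightarrow> slice A j c X = {}"
  using assms unfolding slice_empty_iff map_graph_def by (auto simp: merge_def)

context o_minimal
begin

section \<open>Slices of monotone maps\<close>

lemma monotone_map_continuous_bounded:
  "monotone_coord_map S A B X f \<Longrightarrow> continuous_bounded_map S A B X f"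
  by (erule monotone_coord_map.cases) simp_all

lemma continuous_bounded_mapD:
  assumes "continuous_bounded_map S A B X f"
  shows "finite A" "finite B" "A \<inter> B = {}" "X \<noteq> {}" "semi_monotone S A X" "X \<subseteq> extensional A"
    "openin (powertop_real A) X"
    "continuous_map (subtopology (powertop_real A) X) (powertop_real B) f"
    "bounded_in B (f ` X)" "definable_set S (A \<union> B) (map_graph A B X f)"
  using assms semi_monotone_extensional[of S A X]
  unfolding continuous_bounded_map_def semi_monotone_def[of S A X] by simp_all

lemmas monotone_mapD = continuous_bounded_mapD[OF monotone_map_continuous_bounded]

lemma continuous_bounded_map_slice:
  assumes f: "continuous_bounded_map S A B X f" and j: "j \<in> A" and ne: "slice A j c X \<noteq> {}"
  shows "continuous_bounded_map S (A - {j}) B (slice A j c X) (\<lambda>y. f (y(j := c)))"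
  unfolding continuous_bounded_map_def
proof (intro conjI)
  note D = continuous_bounded_mapD[OF f]
  note pre = slice_eq_preimage[OF j D(6), of c]
  show "finite (A - {j})" "finite B" "(A - {j}) \<inter> B = {}" "slice A j c X \<noteq> {}"
    using D ne by auto
  show "semi_monotone S (A - {j}) (slice A j c X)"
    using D(5,1) j by (rule semi_monotone_slice)
  have "continuous_map (subtopology (powertop_real (A - {j})) (slice A j c X))
      (subtopology (powertop_real A) X) (\<lambda>y. y(j := c))"
    by (rule continuous_map_into_subtopology[OF
          continuous_map_from_subtopology[OF continuous_map_insert_coordinate[OF j]]])
      (auto simp: pre)
  from continuous_map_compose[OF this D(8)]
  show "continuous_map (subtopology (powertop_real (A - {j})) (slice A j c X)) (powertop_real B)
      (\<lambda>y. f (y(j := c)))" by (simp add: comp_def)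
  show "bounded_in B ((\<lambda>y. f (y(j := c))) ` slice A j c X)"
    by (rule bounded_in_subset[OF D(9)]) (auto simp: pre)
  have "j \<notin> B" using j D(3) by blast
  then have "A \<union> B - {j} = A - {j} \<union> B" by blast
  then show "definable_set S (A - {j} \<union> B) (map_graph (A - {j}) B (slice A j c X) (\<lambda>y. f (y(j := c))))"
    using definable_set_slice[OF D(10), of j c] j D(1,2)
    unfolding slice_map_graph[OF j D(3,6)] by auto
qed

text \<open>Here the common system M is read off from the slice rather than from a map g that
  represents it, so slices can be compared as sets of points.\<close>

lemma monotone_map_y_slice:
  assumes f: "monotone_coord_map S A B X f" and A: "card A > 1" and i: "i \<in> B" and l: "l \<in> A"
    and dep: "\<not> independent_of A X (\<lambda>x. f x i) l"
  shows "\<exists>M. \<forall>b. slice (A \<union> B) i b (map_graph A B X f) \<noteq> {} \<longrightarrow>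
    (\<exists>Y g. monotone_coord_map S (A - {l}) (insert l (B - {i})) Y g \<and>
      slice (A \<union> B) i b (map_graph A B X f) = map_graph (A - {l}) (insert l (B - {i})) Y g \<and>
      bases (card A - 1) (A \<union> B - {i}) (slice (A \<union> B) i b (map_graph A B X f)) = M)"
proof -
  note D = monotone_mapD[OF f]
  have un: "A - {l} \<union> insert l (B - {i}) = A \<union> B - {i}" "card (A - {l}) = card A - 1"
    using l i D(1,3) by (auto simp: card_Diff_singleton)
  have "\<exists>M. \<forall>b. {z \<in> map_graph A B X f. z i = b} \<noteq> {} \<longrightarrow>
         (\<exists>Y g. monotone_coord_map S (A - {l}) (insert l (B - {i})) Y g \<and>
           (\<lambda>z. restrict z (A \<union> B - {i})) ` {z \<in> map_graph A B X f. z i = b}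
             = map_graph (A - {l}) (insert l (B - {i})) Y g \<and>
           basis_sets (A - {l}) (insert l (B - {i})) Y g = M)"
    using f
  proof (cases rule: monotone_coord_map.cases)
    case step
    then show ?thesis using i l dep by blast
  qed (use A in auto)
  then obtain M where M: "\<And>b. {z \<in> map_graph A B X f. z i = b} \<noteq> {} \<Longrightarrow>
         \<exists>Y g. monotone_coord_map S (A - {l}) (insert l (B - {i})) Y g \<and>
           (\<lambda>z. restrict z (A \<union> B - {i})) ` {z \<in> map_graph A B X f. z i = b}
             = map_graph (A - {l}) (insert l (B - {i})) Y g \<and>
           basis_sets (A - {l}) (insert l (B - {i})) Y g = M"
    by blast
  show ?thesis
  proof (intro exI[of _ M] allI impI)
    fix b assume "slice (A \<union> B) i b (map_graph A B X f) \<noteq> {}"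
    then have "{z \<in> map_graph A B X f. z i = b} \<noteq> {}" by (simp add: slice_def)
    from M[OF this] obtain Y g where g: "monotone_coord_map S (A - {l}) (insert l (B - {i})) Y g"
        "slice (A \<union> B) i b (map_graph A B X f) = map_graph (A - {l}) (insert l (B - {i})) Y g"
        "basis_sets (A - {l}) (insert l (B - {i})) Y g = M"
      unfolding slice_def by blast
    then have "bases (card A - 1) (A \<union> B - {i}) (slice (A \<union> B) i b (map_graph A B X f)) = M"
      using basis_sets_eq_bases[OF monotone_mapD(6)[OF g(1)]] un by simp
    then show "\<exists>Y g. monotone_coord_map S (A - {l}) (insert l (B - {i})) Y g \<and>
      slice (A \<union> B) i b (map_graph A B X f) = map_graph (A - {l}) (insert l (B - {i})) Y g \<and>
      bases (card A - 1) (A \<union> B - {i}) (slice (A \<union> B) i b (map_graph A B X f)) = M"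
      using g by blast
  qed
qed

text \<open>Over a domain of dimension above one, the slice y_i = f x i is a graph over A - {l}, so
  the value at l is a function of the other x-coordinates there. Over a line, dependence on x_l
  means strict monotonicity.\<close>

lemma dependent_injective:
  assumes f: "monotone_coord_map S A B X f" and i: "i \<in> B" and l: "l \<in> A"
    and dep: "\<not> independent_of A X (\<lambda>x. f x i) l"
    and xy: "x \<in> X" "y \<in> X" "\<forall>k\<in>A - {l}. x k = y k" "f x i = f y i"
  shows "x = y"
proof -
  note D = monotone_mapD[OF f]
  have "x l = y l"
  proof (cases "card A > 1")
    case True
    obtain Y g where g: "monotone_coord_map S (A - {l}) (insert l (B - {i})) Y g"
      "slice (A \<union> B) i (f x i) (map_graph A B X f) = map_graph (A - {l}) (insert l (B - {i})) Y g"
      if "slice (A \<union> B) i (f x i) (map_graph A B X f) \<noteq> {}"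
      using monotone_map_y_slice[OF f True i l dep] by blast
    have iA: "i \<notin> A" using i D(3) by blast
    have mem: "restrict (merge A B (w, f w)) (A \<union> B - {i}) \<in> slice (A \<union> B) i (f x i) (map_graph A B X f)"
      if "w \<in> X" "f w i = f x i" for w
      unfolding slice_def map_graph_def using that iA i
      by (intro imageI CollectI conjI) (auto simp: merge_def)
    then have ne: "slice (A \<union> B) i (f x i) (map_graph A B X f) \<noteq> {}" using xy(1) by blast
    have "restrict (merge A B (x, f x)) (A \<union> B - {i}) = restrict (merge A B (y, f y)) (A \<union> B - {i})"
    proof (rule map_graph_eqI)
      show "Y \<subseteq> extensional (A - {l})" using monotone_mapD(6)[OF g(1)[OF ne]] .
      show "restrict (merge A B (x, f x)) (A \<union> B - {i}) \<in> map_graph (A - {l}) (insert l (B - {i})) Y g"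
        using mem[OF xy(1) refl] unfolding g(2)[OF ne] .
      show "restrict (merge A B (y, f y)) (A \<union> B - {i}) \<in> map_graph (A - {l}) (insert l (B - {i})) Y g"
        using mem[OF xy(2) xy(4)[symmetric]] unfolding g(2)[OF ne] .
      show "\<forall>k\<in>A - {l}. restrict (merge A B (x, f x)) (A \<union> B - {i}) k =
          restrict (merge A B (y, f y)) (A \<union> B - {i}) k"
        using xy(3) by (auto simp: merge_def)
    qed
    from fun_cong[OF this, of l] show ?thesis using l iA by (cases "l = i") (auto simp: merge_def)
  next
    case False
    have "card A \<noteq> 0" using l D(1) by auto
    with False have A1: "card A = 1" by linarith
    then have A: "A = {l}" using l by (auto simp: card_1_singleton_iff)
    have "monotone_function S A X (\<lambda>x. f x i)"
      using f
    proof (cases rule: monotone_coord_map.cases)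
      case line
      then show ?thesis using i by blast
    qed (use A1 in auto)
    then have "strictly_increasing_in A X (\<lambda>x. f x i) l \<or> strictly_decreasing_in A X (\<lambda>x. f x i) l"
      using dep l unfolding monotone_function_def by blast
    then have "\<And>x y. x \<in> X \<Longrightarrow> y \<in> X \<Longrightarrow> x l < y l \<Longrightarrow> f x i \<noteq> f y i"
      unfolding strictly_increasing_in_def strictly_decreasing_in_def A by fastforce
    then show ?thesis using xy by (metis linorder_neqE)
  qed
  then show ?thesis using xy D(6) by (intro extensionalityI[of x A y]) auto
qed

text \<open>Two claims in one induction: the slice is a monotone map, and its basis sets pass to all
  slices at j. The first needs the second in smaller dimension, since a monotone map must itself
  have y-slices with constant systems of basis sets.\<close>

lemma monotone_map_x_slice_aux:
  assumes "monotone_coord_map S A B X f" "j \<in> A" "slice A j c X \<noteq> {}"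
  shows "monotone_coord_map S (A - {j}) B (slice A j c X) (\<lambda>y. f (y(j := c))) \<and>
    (\<forall>T c'. T \<subseteq> A \<union> B - {j} \<longrightarrow> card T = card A - 1 \<longrightarrow>
      inj_on (\<lambda>z. restrict z T) (slice (A \<union> B) j c (map_graph A B X f)) \<longrightarrow>
      inj_on (\<lambda>z. restrict z T) (slice (A \<union> B) j c' (map_graph A B X f)))"
  using assms
proof (induction "card A" arbitrary: A B X f j c rule: less_induct)
  case less
  let ?E = "A \<union> B" and ?F = "map_graph A B X f"
  let ?Y = "slice A j c X" and ?g = "\<lambda>y. f (y(j := c))"
  note f = less.prems(1) and j = less.prems(2) and ne = less.prems(3)
  note D = monotone_mapD[OF f]
  note g = continuous_bounded_map_slice[OF monotone_map_continuous_bounded[OF f] j ne]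
  note Dg = continuous_bounded_mapD[OF g]
  note sl = slice_map_graph[OF j D(3,6)]
  have jB: "j \<notin> B" using j D(3) by blast
  have finE: "finite ?E" using D(1,2) by simp
  have cardA: "card (A - {j}) = card A - 1" using j D(1) by simp
  have insY: "y(j := c) \<in> X" if "y \<in> ?Y" for y
    using that unfolding slice_eq_preimage[OF j D(6)] by blast

  \<comment> \<open>The slice at y_t is a monotone map over A - {l}. As l differs from j, the
    coordinate j stays in its domain, and the induction hypothesis applies to the slice at
    j.\<close>
  have double: "\<exists>Y h. monotone_coord_map S (A - {l} - {j}) (insert l (B - {t})) Y h \<and>
        slice (?E - {t}) j a (slice ?E t b ?F) = map_graph (A - {l} - {j}) (insert l (B - {t})) Y h"
      "T \<subseteq> ?E - {t} - {j} \<Longrightarrow> card T = card A - 2 \<Longrightarrow>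
        inj_on (\<lambda>z. restrict z T) (slice (?E - {t}) j a (slice ?E t b ?F)) \<Longrightarrow>
        inj_on (\<lambda>z. restrict z T) (slice (?E - {t}) j a' (slice ?E t b' ?F))"
    if t: "t \<in> B" and l: "l \<in> A - {j}" and dep: "\<not> independent_of A X (\<lambda>x. f x t) l"
      and nonempty: "slice (?E - {t}) j a (slice ?E t b ?F) \<noteq> {}" for t l a b T a' b'
  proof -
    have lA: "l \<in> A" and jl: "j \<in> A - {l}" using l j by auto
    have small: "card (A - {l}) < card A" using lA D(1) by (rule card_Diff1_less[rotated])
    have "card (A - {l}) \<noteq> 0" using jl D(1) by auto
    then have A2: "card A > 1" using small by linarith
    obtain M where M: "\<And>b. slice ?E t b ?F \<noteq> {} \<Longrightarrow>
      \<exists>Y h. monotone_coord_map S (A - {l}) (insert l (B - {t})) Y h \<and>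
        slice ?E t b ?F = map_graph (A - {l}) (insert l (B - {t})) Y h \<and>
        bases (card A - 1) (?E - {t}) (slice ?E t b ?F) = M"
      using monotone_map_y_slice[OF f A2 t lA dep] by blast
    have ne_b: "slice ?E t b ?F \<noteq> {}" using nonempty by (auto simp: slice_def)
    obtain Y h where h: "monotone_coord_map S (A - {l}) (insert l (B - {t})) Y h"
        "slice ?E t b ?F = map_graph (A - {l}) (insert l (B - {t})) Y h"
      and Mb: "bases (card A - 1) (?E - {t}) (slice ?E t b ?F) = M"
      using M[OF ne_b] by blast
    have un: "A - {l} \<union> insert l (B - {t}) = ?E - {t}" using lA t D(3) by auto
    have ne_h: "slice (A - {l}) j a Y \<noteq> {}"
      using nonempty slice_empty_map_graph[OF jl] un h(2) by metis
    note IH = less.hyps[OF small h(1) jl ne_h]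
    show "\<exists>Y h. monotone_coord_map S (A - {l} - {j}) (insert l (B - {t})) Y h \<and>
        slice (?E - {t}) j a (slice ?E t b ?F) = map_graph (A - {l} - {j}) (insert l (B - {t})) Y h"
      using IH slice_map_graph[OF jl monotone_mapD(3,6)[OF h(1)]] unfolding h(2) un by metis
    show "inj_on (\<lambda>z. restrict z T) (slice (?E - {t}) j a' (slice ?E t b' ?F))"
      if T: "T \<subseteq> ?E - {t} - {j}" "card T = card A - 2"
        and inj: "inj_on (\<lambda>z. restrict z T) (slice (?E - {t}) j a (slice ?E t b ?F))"
    proof (cases "slice ?E t b' ?F = {}")
      case True
      show ?thesis unfolding True by (simp add: slice_def)
    next
      case False
      have ext: "slice ?E t b'' ?F \<subseteq> extensional (?E - {t})" for b''
        by (auto simp: slice_def)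
      \<comment> \<open>The value at j is varied by the induction hypothesis. With all values at j
        covered, \<open>insert j T\<close> is a basis set of the slice at y_t, and therefore of
        every non-empty slice at y_t by the choice of M.\<close>
      have "card T = card (A - {l}) - 1" using T(2) lA D(1) by simp
      then have "inj_on (\<lambda>z. restrict z T) (slice (?E - {t}) j a'' (slice ?E t b ?F))" for a''
        using IH T(1) inj unfolding h(2) un by blast
      then have "inj_on (\<lambda>z. restrict z (insert j T)) (slice ?E t b ?F)"
        unfolding inj_on_insert[OF ext T(1)] by blast
      moreover have "card (insert j T) = card A - 1"
        using T A2 finite_subset[OF T(1)] finE by (subst card_insert_disjoint) auto
      moreover have "insert j T \<subseteq> ?E - {t}" using T(1) j t D(3) by auto
      ultimately have "insert j T \<in> M" using Mb unfolding bases_def by blast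
      then have "inj_on (\<lambda>z. restrict z (insert j T)) (slice ?E t b' ?F)"
        using M[OF False] unfolding bases_def by blast
      then show ?thesis unfolding inj_on_insert[OF ext T(1)] by blast
    qed
  qed

  have ind_g: "independent_of (A - {j}) ?Y (\<lambda>y. ?g y i) l"
    if "independent_of A X (\<lambda>x. f x i) l" "l \<in> A - {j}" for i l
    unfolding independent_of_def
  proof (intro ballI impI)
    fix x y assume *: "x \<in> ?Y" "y \<in> ?Y" "(\<forall>k\<in>A - {j} - {l}. x k = y k) \<and> x l < y l"
    show "?g x i = ?g y i"
      by (rule independent_of_eq[OF that(1) D(6) insY insY]) (use * in auto)
  qed

  have mono: "monotone_coord_map S (A - {j}) B ?Y ?g"
  proof -
    consider "card (A - {j}) = 0" | "card (A - {j}) = 1" | "card (A - {j}) > 1" by linarith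
    then show ?thesis
    proof cases
      case 1
      with g show ?thesis by (rule monotone_coord_map.point)
    next
      case 2
      then obtain l where l: "A - {j} = {l}" by (auto simp: card_1_singleton_iff)
      have "monotone_function S (A - {j}) ?Y (\<lambda>y. ?g y i)" if i: "i \<in> B" for i
        unfolding l
      proof (rule monotone_function_line)
        show "semi_monotone S {l} ?Y" "?Y \<noteq> {}" using Dg(5) ne unfolding l .
        show "continuous_map (subtopology (powertop_real {l}) ?Y) euclideanreal (\<lambda>y. ?g y i)"
          using Dg(8) i unfolding l continuous_map_componentwise by blast
        obtain m where "\<forall>y\<in>?g ` ?Y. \<bar>y i\<bar> \<le> m" using Dg(9) i unfolding bounded_in_def by blast
        then show "bounded ((\<lambda>y. ?g y i) ` ?Y)" unfolding bounded_iff by (intro exI[of _ m]) auto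
        show "definable_fun S {l} ?Y (\<lambda>y. ?g y i)"
          using definable_component[OF Dg(10,1,3,6) i] unfolding l .
        \<comment> \<open>Now A = {j, l}. If f_i is independent of x_l, the component is constant on
          the slice; otherwise x_j = c and y_i determine the point by
          \<open>dependent_injective\<close>.\<close>
        show "inj_on (\<lambda>y. ?g y i) ?Y \<or> (\<forall>x\<in>?Y. \<forall>y\<in>?Y. ?g x i = ?g y i)"
        proof (cases "independent_of A X (\<lambda>x. f x i) l")
          case True
          then have ind: "independent_of {l} ?Y (\<lambda>y. ?g y i) l" using ind_g[of i l] l by auto
          have "?g x i = ?g y i" if "x \<in> ?Y" "y \<in> ?Y" for x y
            by (rule independent_of_eq[OF ind _ that]) (use Dg(6) l in auto)
          then show ?thesis by blast
        next
          case False
          have "x = y" if xy: "x \<in> ?Y" "y \<in> ?Y" "?g x i = ?g y i" for x y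
          proof -
            have lj: "l \<in> A" "l \<noteq> j" using l by blast+
            have kj: "k = j" if "k \<in> A - {l}" for k using l that by blast
            have eqj: "\<forall>k\<in>A - {l}. (x(j := c)) k = (y(j := c)) k" using kj by simp
            have "x(j := c) = y(j := c)"
              by (rule dependent_injective[of A B X f i l "x(j := c)" "y(j := c)",
                    OF f i lj(1) False insY[OF xy(1)] insY[OF xy(2)] eqj xy(3)])
            from fun_cong[OF this, of l] lj(2) have "x l = y l" by simp
            then show "x = y" using xy Dg(6)[unfolded l] by (intro extensionalityI[of x "{l}" y]) auto
          qed
          then show ?thesis unfolding inj_on_def by blast
        qed
      qed
      with g 2 show ?thesis by (intro monotone_coord_map.line) auto
    next
      case 3
      show ?thesis
      proof (rule monotone_coord_map.step[OF g 3], intro ballI impI)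
        fix i l assume i: "i \<in> B" and l: "l \<in> A - {j}"
          and dep_g: "\<not> independent_of (A - {j}) ?Y (\<lambda>y. ?g y i) l"
        have dep: "\<not> independent_of A X (\<lambda>x. f x i) l" using ind_g[OF _ l] dep_g by blast
        have ij: "i \<in> ?E" "j \<in> ?E" "i \<noteq> j" using i j jB by auto
        have un: "A - {j} \<union> B - {i} = ?E - {j} - {i}" "A - {l} - {j} = A - {j} - {l}"
          "?E - {i} - {j} = A - {j} - {l} \<union> insert l (B - {i})"
          "card (A - {j} - {l}) = card A - 2"
          using jB l i j D(1,3) by (auto simp: card_Diff_singleton)
        let ?Z = "\<lambda>b. slice (?E - {i}) j c (slice ?E i b ?F)"
        have Z: "(\<lambda>z. restrict z (A - {j} \<union> B - {i})) ` {z \<in> map_graph (A - {j}) B ?Y ?g. z i = b} = ?Z b" for b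
          unfolding slice_commute[OF ij] sl un(1) unfolding slice_def[of "?E - {j}"] ..
        \<comment> \<open>M has to be fixed before b. Any non-empty double slice may represent it,
          since \<open>double\<close> compares any two of them; if there is none, the condition on b
          is void.\<close>
        define M where "M = bases (card A - 2) (?E - {i} - {j}) (?Z (SOME b. ?Z b \<noteq> {}))"
        show "\<exists>M. \<forall>b. {z \<in> map_graph (A - {j}) B ?Y ?g. z i = b} \<noteq> {} \<longrightarrow>
         (\<exists>Y h. monotone_coord_map S (A - {j} - {l}) (insert l (B - {i})) Y h \<and>
           (\<lambda>z. restrict z (A - {j} \<union> B - {i})) ` {z \<in> map_graph (A - {j}) B ?Y ?g. z i = b}
             = map_graph (A - {j} - {l}) (insert l (B - {i})) Y h \<and>
           basis_sets (A - {j} - {l}) (insert l (B - {i})) Y h = M)"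
        proof (intro exI[of _ M] allI impI)
          fix b assume "{z \<in> map_graph (A - {j}) B ?Y ?g. z i = b} \<noteq> {}"
          then have nb: "?Z b \<noteq> {}" unfolding Z[symmetric] by blast
          then have n0: "?Z (SOME b. ?Z b \<noteq> {}) \<noteq> {}" by (rule someI)
          obtain Y h where h: "monotone_coord_map S (A - {j} - {l}) (insert l (B - {i})) Y h"
              "?Z b = map_graph (A - {j} - {l}) (insert l (B - {i})) Y h"
            using double(1)[OF i l dep nb] unfolding un(2) by blast
          have "basis_sets (A - {j} - {l}) (insert l (B - {i})) Y h =
              bases (card A - 2) (?E - {i} - {j}) (?Z b)"
            unfolding basis_sets_eq_bases[OF monotone_mapD(6)[OF h(1)]] h(2) un(3,4) ..
          also have "\<dots> = M"
            unfolding M_def bases_def using double(2)[OF i l dep nb] double(2)[OF i l dep n0] by blast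
          finally have bM: "basis_sets (A - {j} - {l}) (insert l (B - {i})) Y h = M" .
          show "\<exists>Y h. monotone_coord_map S (A - {j} - {l}) (insert l (B - {i})) Y h \<and>
             (\<lambda>z. restrict z (A - {j} \<union> B - {i})) ` {z \<in> map_graph (A - {j}) B ?Y ?g. z i = b}
               = map_graph (A - {j} - {l}) (insert l (B - {i})) Y h \<and>
             basis_sets (A - {j} - {l}) (insert l (B - {i})) Y h = M"
            unfolding Z by (intro exI[of _ Y] exI[of _ h] conjI h bM)
        qed
      qed
    qed
  qed

  have uniform: "inj_on (\<lambda>z. restrict z T) (slice ?E j c' ?F)"
    if T: "T \<subseteq> ?E - {j}" "card T = card A - 1" and inj: "inj_on (\<lambda>z. restrict z T) (slice ?E j c ?F)"
    for T c'
  proof (cases "A - {j} \<subseteq> T")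
    \<comment> \<open>A point of the graph is determined by its x-coordinates, and all but x_j are
      in T.\<close>
    case True
    have "z = w" if "z \<in> ?F" "w \<in> ?F" "z j = c'" "w j = c'" "\<forall>k\<in>T. z k = w k" for z w
      by (rule map_graph_eqI[OF that(1,2) D(6)]) (use that True in fastforce)
    then show ?thesis unfolding inj_on_slice[OF map_graph_extensional T(1)] by blast
  next
    case False
    \<comment> \<open>Two points of the slice that differ in x_l but in no other x-coordinate must
      be separated by some t in T. As l is not in T, this t is a y-coordinate, and f_t depends on
      x_l; this gives access to \<open>double\<close>.\<close>
    then obtain l where l: "l \<in> A - {j}" "l \<notin> T" by blast
    obtain x where x: "x \<in> ?Y" using ne by blast
    obtain y where y: "y \<in> ?Y" "y l \<noteq> x l" "\<forall>k\<in>A - {j} - {l}. y k = x k"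
      using openin_move_coordinate[OF Dg(7) x Dg(1) l(1)] by blast
    let ?m = "\<lambda>y. merge (A - {j}) B (y, ?g y)"
    have m: "?m y \<in> slice ?E j c ?F" if "y \<in> ?Y" for y
      using that unfolding sl unfolding map_graph_def by blast
    have "?m x l \<noteq> ?m y l" using l(1) y(2) by (simp add: merge_def)
    then have "restrict (?m x) T \<noteq> restrict (?m y) T"
      using inj_onD[OF inj _ m[OF x] m[OF y(1)]] by metis
    then obtain t where t: "t \<in> T" "?m x t \<noteq> ?m y t" by (auto simp: restrict_eq_iff)
    have tA: "t \<notin> A - {j}"
    proof
      assume tA: "t \<in> A - {j}"
      then have "t \<in> A - {j} - {l}" using t(1) l(2) by blast
      then have "y t = x t" using y(3) by blast
      then show False using t(2) tA by (simp add: merge_def)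
    qed
    then have tB: "t \<in> B" using t(1) T(1) by blast
    have tg: "?g x t \<noteq> ?g y t"
      using t(2) tA tB by (auto simp: merge_def split: if_splits)
    have dep: "\<not> independent_of A X (\<lambda>x. f x t) l"
    proof
      assume ind: "independent_of A X (\<lambda>x. f x t) l"
      have "?g x t = ?g y t"
        by (rule independent_of_eq[OF ind D(6) insY[OF x] insY[OF y(1)]]) (use y(3) in auto)
      then show False using tg by simp
    qed
    have tj: "t \<in> ?E" "j \<in> ?E" "t \<noteq> j" using tB j jB by auto
    have T': "T - {t} \<subseteq> ?E - {j} - {t}" "T - {t} \<subseteq> ?E - {t} - {j}" "insert t (T - {t}) = T"
      "card (T - {t}) = card A - 2"
      using T t(1) by (auto simp: card_Diff_singleton)
    have ext: "slice ?E j a ?F \<subseteq> extensional (?E - {j})" for a by (auto simp: slice_def)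
    have "?m x \<in> {z \<in> slice ?E j c ?F. z t = ?m x t}" using m[OF x] by simp
    then have "slice (?E - {j}) t (?m x t) (slice ?E j c ?F) \<noteq> {}"
      unfolding slice_def[of "?E - {j}"] by blast
    then have ne2: "slice (?E - {t}) j c (slice ?E t (?m x t) ?F) \<noteq> {}"
      unfolding slice_commute[OF tj] .
    \<comment> \<open>Injectivity of T on a slice at j is tested on the double slices at j and t,
      and \<open>double\<close> carries it from one non-empty double slice to all of them.\<close>
    have "inj_on (\<lambda>z. restrict z (T - {t})) (slice (?E - {j}) t (?m x t) (slice ?E j c ?F))"
      using inj_on_insert[OF ext T'(1)] inj unfolding T'(3) by blast
    then have "inj_on (\<lambda>z. restrict z (T - {t})) (slice (?E - {j}) t b (slice ?E j c' ?F))" for b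
      using double(2)[OF tB l(1) dep ne2 T'(2,4)] unfolding slice_commute[OF tj] by blast
    then show ?thesis using inj_on_insert[OF ext T'(1)] unfolding T'(3) by blast
  qed
  show ?case using mono uniform by blast
qed

end

section \<open>Monotone maps form a class closed under slicing\<close>

text \<open>A and B are existentially quantified because a slice at y_i turns some x_l into a range
  coordinate; only the number n of domain coordinates is kept.\<close>

definition monotone_graph ::
    "(nat \<Rightarrow> real list set set) \<Rightarrow> nat \<Rightarrow> 'v set \<Rightarrow> ('v \<Rightarrow> real) set \<Rightarrow> bool" where
  "monotone_graph S n E F \<longleftrightarrow>
     (\<exists>A B X f. A \<union> B = E \<and> card A = n \<and> monotone_coord_map S A B X f \<and> F = map_graph A B X f)"

lemma monotone_graphE:
  assumes "monotone_graph S n E F"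
  obtains A B X f where "A \<union> B = E" "card A = n" "monotone_coord_map S A B X f" "F = map_graph A B X f"
  using assms unfolding monotone_graph_def by blast

lemma bases_singleton:
  assumes "finite E"
  shows "bases 0 E {p} = {{}}"
proof -
  have "T = {}" if "T \<subseteq> E" "card T = 0" for T
    using finite_subset[OF that(1) assms] that(2) by simp
  then show ?thesis by (auto simp: bases_def)
qed

context o_minimal
begin

text \<open>A point over E is the graph of a map from the one-point span of no coordinates, which
  falls under the case \<open>point\<close>.\<close>

lemma monotone_graph_singleton:
  fixes E :: "'v set"
  assumes E: "finite E" and z: "z \<in> extensional E"
  shows "monotone_graph S 0 E {z}"
proof -
  let ?u = "(\<lambda>_. undefined) :: 'v \<Rightarrow> real"
  have top: "topspace (powertop_real {}) = {?u}"
    unfolding topspace_powertop_real by (rule extensional_empty)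
  have graph: "map_graph {} E {?u} (\<lambda>_. z) = {z}"
    using z by (auto simp: map_graph_def merge_def extensional_def fun_eq_iff)
  have "semi_monotone S {} {?u}"
    unfolding semi_monotone_def
  proof (intro conjI allI impI)
    show "openin (powertop_real {}) {?u}" unfolding top[symmetric] by (rule openin_topspace)
    show "bounded_in {} {?u}" unfolding bounded_in_def by simp
    show "definable_set S {} {?u}" by (rule definable_set_singleton) auto
    fix C :: "('v \<Rightarrow> real) set"
    show "connectedin (powertop_real {}) ({?u} \<inter> C)"
    proof (cases "?u \<in> C")
      case True
      then have eq: "{?u} \<inter> C = {?u}" by blast
      show ?thesis unfolding eq connectedin_sing top by (rule singletonI)
    next
      case False
      then have eq: "{?u} \<inter> C = {}" by blast
      show ?thesis unfolding eq by (rule connectedin_empty)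
    qed
  qed
  moreover have "z \<in> topspace (powertop_real E)" unfolding topspace_powertop_real by (rule z)
  then have "continuous_map (subtopology (powertop_real {}) {?u}) (powertop_real E) (\<lambda>_. z)"
    by (intro continuous_map_const[THEN iffD2] disjI2)
  moreover have "bounded_in E ((\<lambda>_. z) ` {?u})"
    unfolding bounded_in_def
    by (rule exI[of _ "\<Sum>i\<in>E. \<bar>z i\<bar>"]) (use E in \<open>auto intro: member_le_sum\<close>)
  moreover have "definable_set S ({} \<union> E) (map_graph {} E {?u} (\<lambda>_. z))"
    unfolding graph using E z by (auto intro: definable_set_singleton)
  ultimately have "continuous_bounded_map S {} E {?u} (\<lambda>_. z)"
    unfolding continuous_bounded_map_def using E by simp
  then have "monotone_coord_map S {} E {?u} (\<lambda>_. z)"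
    by (rule monotone_coord_map.point) simp
  then show ?thesis
    unfolding monotone_graph_def using graph by (metis Un_empty_left card.empty)
qed

lemma monotone_graph_slice:
  assumes F: "monotone_graph S (Suc n) E F" and v: "v \<in> E" "\<not> constant_at v F"
  shows "z \<in> F \<Longrightarrow> monotone_graph S n (E - {v}) (slice E v (z v) F)"
    and "z \<in> F \<Longrightarrow> w \<in> F \<Longrightarrow>
      bases n (E - {v}) (slice E v (z v) F) = bases n (E - {v}) (slice E v (w v) F)"
proof -
  obtain A B X f where AB: "A \<union> B = E" and A: "card A = Suc n" and f: "monotone_coord_map S A B X f"
    and F: "F = map_graph A B X f"
    using F by (rule monotone_graphE)
  note D = monotone_mapD[OF f]
  have finE: "finite E" using AB D(1,2) by blast
  have ne: "slice E v (z v) F \<noteq> {}" if "z \<in> F" for z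
    using that unfolding slice_empty_iff by blast
  have ext: "F \<subseteq> extensional E" unfolding F AB[symmetric] by (rule map_graph_extensional)
  have "(\<forall>z\<in>F. monotone_graph S n (E - {v}) (slice E v (z v) F)) \<and>
    (\<forall>z\<in>F. \<forall>w\<in>F. bases n (E - {v}) (slice E v (z v) F) = bases n (E - {v}) (slice E v (w v) F))"
  proof (cases "v \<in> A")
    case vA: True
    have neX: "slice A v (z v) X \<noteq> {}" if "z \<in> F" for z
      using ne[OF that] unfolding F AB[symmetric] slice_empty_map_graph[OF vA] .
    note aux = monotone_map_x_slice_aux[OF f vA neX]
    have "monotone_graph S n (E - {v}) (slice E v (z v) F)" if z: "z \<in> F" for z
    proof -
      have "A - {v} \<union> B = E - {v}" "card (A - {v}) = n" using vA D(1,3) A AB by auto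
      then show ?thesis
        unfolding monotone_graph_def using aux[OF z] slice_map_graph[OF vA D(3,6)] AB F by metis
    qed
    \<comment> \<open>One inclusion is enough, as z and w are interchangeable.\<close>
    moreover have "bases n (E - {v}) (slice E v (z v) F) \<subseteq> bases n (E - {v}) (slice E v (w v) F)"
      if z: "z \<in> F" "w \<in> F" for z w
      using aux[OF z(1)] unfolding bases_def F[symmetric] AB A by auto
    ultimately show ?thesis by blast
  next
    case False
    then have vB: "v \<in> B" using v(1) AB by blast
    have "\<exists>l\<in>A. \<not> independent_of A X (\<lambda>x. f x v) l"
    proof (rule ccontr)
      assume *: "\<not> (\<exists>l\<in>A. \<not> independent_of A X (\<lambda>x. f x v) l)"
      have ind: "independent_of A X (\<lambda>x. f x v) l" if "l \<in> A" for l using * that by blast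
      have eq: "f x v = f y v" if "x \<in> X" "y \<in> X" for x y
        by (rule constant_if_independent[where h = "\<lambda>x. f x v" and A = A and X = X,
              OF D(7) semi_monotone_connected[OF D(5)] D(1) ind that])
      have "constant_at v F"
        unfolding constant_at_def
      proof (intro ballI)
        fix z w assume "z \<in> F" "w \<in> F"
        then obtain x y where "x \<in> X" "z = merge A B (x, f x)" "y \<in> X" "w = merge A B (y, f y)"
          unfolding F map_graph_def by blast
        then show "z v = w v" using vB False eq[of x y] by (simp add: merge_def)
      qed
      then show False using v(2) by simp
    qed
    then obtain l where l: "l \<in> A" "\<not> independent_of A X (\<lambda>x. f x v) l" by blast
    show ?thesis
    proof (cases "n = 0")
      case False
      then have "card A > 1" using A by simp
      from monotone_map_y_slice[OF f this vB l, unfolded AB F[symmetric] A diff_Suc_1] obtain M where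
        M: "\<forall>b. slice E v b F \<noteq> {} \<longrightarrow> (\<exists>Y g. monotone_coord_map S (A - {l}) (insert l (B - {v})) Y g \<and>
          slice E v b F = map_graph (A - {l}) (insert l (B - {v})) Y g \<and>
          bases n (E - {v}) (slice E v b F) = M)"
        by (elim exE)
      have AA: "A - {l} \<union> insert l (B - {v}) = E - {v}" "card (A - {l}) = n"
        using l vB A AB D(1,3) by auto
      have "monotone_graph S n (E - {v}) (slice E v (z v) F) \<and>
          bases n (E - {v}) (slice E v (z v) F) = M" if "z \<in> F" for z
        using M[rule_format, OF ne[OF that]] AA unfolding monotone_graph_def by blast
      then show ?thesis by simp
    next
      \<comment> \<open>Over a line the definition has no clause on slices. Here y_v is injective on
        the curve, so each non-empty slice is a single point.\<close>
      case True
      have Al: "A = {l}" using A l(1) True by (auto simp: card_1_singleton_iff)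
      have eq: "w = z" if zw: "z \<in> F" "w \<in> F" "w v = z v" for z w
      proof -
        obtain x y where x: "x \<in> X" "z = merge A B (x, f x)" and y: "y \<in> X" "w = merge A B (y, f y)"
          using zw(1,2) unfolding F map_graph_def by blast
        have "f y v = f x v" using zw(3) vB \<open>v \<notin> A\<close> unfolding x(2) y(2) by (simp add: merge_def)
        then have "y = x" using dependent_injective[OF f vB l y(1) x(1)] Al by simp
        then show ?thesis using x y by simp
      qed
      have sing: "slice E v (z v) F = {restrict z (E - {v})}" if "z \<in> F" for z
      proof -
        have "{w \<in> F. w v = z v} = {z}" using eq that by blast
        then show ?thesis unfolding slice_def by simp
      qed
      have "monotone_graph S 0 (E - {v}) {restrict z (E - {v})}" for z
        by (rule monotone_graph_singleton) (use finE in auto)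
      then show ?thesis using True finE by (simp add: sing bases_singleton)
    qed
  qed
  then show "z \<in> F \<Longrightarrow> monotone_graph S n (E - {v}) (slice E v (z v) F)"
    "z \<in> F \<Longrightarrow> w \<in> F \<Longrightarrow>
      bases n (E - {v}) (slice E v (z v) F) = bases n (E - {v}) (slice E v (w v) F)"
    by blast+
qed

lemma slice_class_monotone_graph: "slice_class (monotone_graph S :: nat \<Rightarrow> 'v set \<Rightarrow> _)"
proof
  fix n and E :: "'v set" and F and v z w
  show "finite E" "F \<subseteq> extensional E" "F \<noteq> {}" if G: "monotone_graph S n E F"
  proof -
    obtain A B X f where AB: "A \<union> B = E" and "card A = n" and f: "monotone_coord_map S A B X f"
      and F: "F = map_graph A B X f"
      using G by (rule monotone_graphE)
    note D = monotone_mapD[OF f]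
    show "finite E" using AB D(1,2) by blast
    show "F \<subseteq> extensional E" unfolding F AB[symmetric] by (rule map_graph_extensional)
    show "F \<noteq> {}" using D(4) unfolding F map_graph_def by simp
  qed
  show "constant_at v F" if G: "monotone_graph S 0 E F"
  proof -
    obtain A B X f where "A \<union> B = E" and "card A = 0" and f: "monotone_coord_map S A B X f"
      and F: "F = map_graph A B X f"
      using G by (rule monotone_graphE)
    note D = monotone_mapD[OF f]
    have "A = {}" using \<open>card A = 0\<close> D(1) by simp
    then have "z = w" if "z \<in> F" "w \<in> F" for z w
      using map_graph_eqI[OF that[unfolded F] D(6)] by simp
    then show ?thesis unfolding constant_at_def by blast
  qed
  show "\<exists>v\<in>E. \<not> constant_at v F" if G: "monotone_graph S (Suc n) E F"
  proof -
    obtain A B X f where AB: "A \<union> B = E" and A: "card A = Suc n" and f: "monotone_coord_map S A B X f"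
      and F: "F = map_graph A B X f"
      using G by (rule monotone_graphE)
    note D = monotone_mapD[OF f]
    obtain l where l: "l \<in> A" using A by fastforce
    obtain x where x: "x \<in> X" using D(4) by blast
    obtain y where y: "y \<in> X" "y l \<noteq> x l"
      using openin_move_coordinate[OF D(7) x D(1) l] by blast
    have "merge A B (x, f x) \<in> F" "merge A B (y, f y) \<in> F"
      using x y(1) unfolding F map_graph_def by auto
    moreover have "merge A B (x, f x) l \<noteq> merge A B (y, f y) l" using y(2) l by (simp add: merge_def)
    ultimately have "\<not> constant_at l F" unfolding constant_at_def by metis
    then show ?thesis using l AB by blast
  qed
qed (fact monotone_graph_slice)+

end

section \<open>The matroid of a monotone map, its contractions and the dimension of
  intersections\<close>

lemma card_x_coords: "card (x_coords n) = n"
  unfolding x_coords_def by (subst card_image) (auto simp: inj_on_def)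

text \<open>The prescribed values form one function c that is read only on I. An intersection may be
  a graph over several choices of A, so one claim provides a representation and another fixes the
  basis sets of every representation.\<close>

theorem theorem3p14:
  fixes S :: "nat \<Rightarrow> real list set set"
    and n k :: nat
    and X :: "(coord \<Rightarrow> real) set"
    and f :: "(coord \<Rightarrow> real) \<Rightarrow> coord \<Rightarrow> real"
    and E :: "coord set"
    and F :: "(coord \<Rightarrow> real) set"
    and m :: "coord set set"
  defines "E \<equiv> x_coords n \<union> y_coords k"
    and "F \<equiv> map_graph (x_coords n) (y_coords k) X f"
    and "m \<equiv> basis_sets (x_coords n) (y_coords k) X f"
  assumes "o_minimal_structure S"
    and "X \<noteq> {}"
    and "semi_monotone S (x_coords n) X"
    and "monotone_coord_map S (x_coords n) (y_coords k) X f"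
  shows "matroid_of_rank E m n \<and>
    (\<forall>I. independent_in m I \<longrightarrow>
       matroid_of_rank (E - I) (matroid_contraction E m I) (n - card I) \<and>
       (\<forall>c. {z \<in> F. \<forall>v\<in>I. z v = c v} \<noteq> {} \<longrightarrow>
          (\<exists>A B Y g. graph_of_monotone_map S E I {z \<in> F. \<forall>v\<in>I. z v = c v} A B Y g) \<and>
          (\<forall>A B Y g. graph_of_monotone_map S E I {z \<in> F. \<forall>v\<in>I. z v = c v} A B Y g \<longrightarrow>
             basis_sets A B Y g = matroid_contraction E m I) \<and>
          definable_dim E {z \<in> F. \<forall>v\<in>I. z v = c v} = n - card I))"
proof -
  interpret o_minimal S by unfold_locales fact
  interpret slice_class "monotone_graph S :: nat \<Rightarrow> coord set \<Rightarrow> _"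
    by (rule slice_class_monotone_graph)
  note f = \<open>monotone_coord_map S (x_coords n) (y_coords k) X f\<close>
  have G: "monotone_graph S n E F"
    unfolding monotone_graph_def using f card_x_coords E_def F_def by metis
  have m: "m = bases n E F"
    unfolding m_def E_def F_def basis_sets_eq_bases[OF monotone_mapD(6)[OF f]] card_x_coords ..
  have finE: "finite E" using finite_ground[OF G] .
  have mat: "matroid_of_rank E m n" unfolding m by (rule matroid_bases[OF G])
  show ?thesis
  proof (intro conjI allI impI)
    show "matroid_of_rank E m n" by (rule mat)
    fix I assume I: "independent_in m I"
    note con = matroid_contraction_independent[OF mat I]
    show "matroid_of_rank (E - I) (matroid_contraction E m I) (n - card I)"
      unfolding con by (rule matroid_of_rank_contraction[OF mat I])
    fix c assume ne: "{z \<in> F. \<forall>v\<in>I. z v = c v} \<noteq> {}"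
    let ?Z = "{z \<in> F. \<forall>v\<in>I. z v = c v}"
    let ?Z' = "(\<lambda>z. restrict z (E - I)) ` ?Z"
    obtain T where T: "T \<in> bases n E F" "I \<subseteq> T" using I unfolding independent_in_def m by blast
    note slI = slice_independent[OF G T ne]
    have G': "monotone_graph S (n - card I) (E - I) ?Z'" by (rule slI[THEN conjunct1])
    have bases': "bases (n - card I) (E - I) ?Z' = matroid_contraction E m I"
      unfolding con unfolding m by (rule slI[THEN conjunct2])
    obtain A B Y g where AB: "A \<union> B = E - I" and A: "card A = n - card I"
      and g: "monotone_coord_map S A B Y g" and Z': "?Z' = map_graph A B Y g"
      using G' by (rule monotone_graphE)
    note D = monotone_mapD[OF g]
    show "\<exists>A B Y g. graph_of_monotone_map S E I ?Z A B Y g"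
      unfolding graph_of_monotone_map_def
      by (rule exI[of _ A], rule exI[of _ B], rule exI[of _ Y], rule exI[of _ g])
        (intro conjI AB D(3,4,5) g Z')
    show "basis_sets A B Y g = matroid_contraction E m I"
      if "graph_of_monotone_map S E I ?Z A B Y g" for A B Y g
    proof -
      note gr = that[unfolded graph_of_monotone_map_def]
      have AB: "A \<union> B = E - I" using gr by (elim conjE)
      have g: "monotone_coord_map S A B Y g" using gr by (elim conjE)
      have Z': "?Z' = map_graph A B Y g" using gr by (elim conjE)
      \<comment> \<open>This representation may use another domain A than the one obtained above,
        but \<open>rank_unique\<close> forces the same number of domain coordinates.\<close>
      have "monotone_graph S (card A) (E - I) ?Z'"
        unfolding monotone_graph_def
        by (rule exI[of _ A], rule exI[of _ B], rule exI[of _ Y], rule exI[of _ g])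
          (intro conjI AB refl g Z')
      then have "card A = n - card I" using G' by (rule rank_unique)
      then show ?thesis
        using bases' unfolding basis_sets_eq_bases[OF monotone_mapD(6)[OF g]] AB Z' by simp
    qed
    show "definable_dim E ?Z = n - card I"
      unfolding definable_dim_def
    proof (rule Max_eqI)
      show "finite {card T | T. T \<subseteq> E \<and> powertop_real T interior_of ((\<lambda>z. restrict z T) ` ?Z) \<noteq> {}}"
        by (rule finite_subset[of _ "card ` Pow E"]) (use finE in auto)
    next
      fix d assume "d \<in> {card T | T. T \<subseteq> E \<and> powertop_real T interior_of ((\<lambda>z. restrict z T) ` ?Z) \<noteq> {}}"
      then obtain T p where d: "d = card T" and T: "T \<subseteq> E"
        and p: "p \<in> powertop_real T interior_of ((\<lambda>z. restrict z T) ` ?Z)" by blast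
      have finT: "finite T" using T finE by (rule finite_subset)
      obtain e where e: "e > 0" "open_box T p e \<subseteq> powertop_real T interior_of ((\<lambda>z. restrict z T) ` ?Z)"
        using openin_contains_open_box[OF openin_interior_of p finT] by blast
      \<comment> \<open>Each of the values p i and p i + e / 2 is admissible at i in a box of radius
        e around p, so every combination of them is attained on the intersection.\<close>
      have hit: "\<exists>z\<in>?Z. \<forall>i\<in>T. z i = w i" if "\<And>i. i \<in> T \<Longrightarrow> w i \<in> {p i, p i + e / 2}" for w
      proof -
        have "\<bar>w i - p i\<bar> < e" if "i \<in> T" for i
          using \<open>\<And>i. i \<in> T \<Longrightarrow> w i \<in> _ i\<close>[OF that] e(1) by auto
        then have "restrict w T \<in> open_box T p e"
          unfolding mem_open_box by simp
        then have "restrict w T \<in> (\<lambda>z. restrict z T) ` ?Z"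
          by (rule subsetD[OF subset_trans[OF e(2) interior_of_subset]])
        then obtain z where "restrict w T = restrict z T" "z \<in> ?Z" by (rule imageE)
        then show ?thesis unfolding restrict_eq_iff by (intro bexI[of _ z]) auto
      qed
      \<comment> \<open>On the intersection a coordinate of I has one value only, while the box
        provides two.\<close>
      have "i \<notin> I" if i: "i \<in> T" for i
      proof
        assume iI: "i \<in> I"
        have "\<exists>z\<in>?Z. \<forall>i\<in>T. z i = p i" by (rule hit) simp
        then have "p i = c i" using i iI by auto
        moreover have "\<exists>z\<in>?Z. \<forall>i\<in>T. z i = p i + e / 2" by (rule hit) simp
        then have "p i + e / 2 = c i" using i iI by auto
        ultimately show False using e(1) by simp
      qed
      then have TI: "T \<subseteq> E - I" using T by blast
      show "d \<le> n - card I"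
        unfolding d
      proof (rule card_le_if_shattered[OF G' TI])
        show "p i \<noteq> p i + e / 2" for i using e(1) by simp
        fix w assume "\<And>i. i \<in> T \<Longrightarrow> w i \<in> {p i, p i + e / 2}"
        then obtain z where z: "z \<in> ?Z" "\<forall>i\<in>T. z i = w i" using hit by blast
        then have "\<forall>i\<in>T. restrict z (E - I) i = w i" using TI by auto
        then show "\<exists>z\<in>?Z'. \<forall>i\<in>T. z i = w i" using z(1) by blast
      qed
    next
      \<comment> \<open>The maximum is attained at A: the projection to the domain coordinates of
        the representing map is its domain Y, which is open and non-empty.\<close>
      have "(\<lambda>z. restrict z A) ` ?Z = (\<lambda>z. restrict z A) ` ?Z'"
      proof -
        have "restrict (restrict z (E - I)) A = restrict z A" for z :: "coord \<Rightarrow> real"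
          using AB by (auto simp: fun_eq_iff)
        then show ?thesis unfolding image_image by simp
      qed
      also have "\<dots> = (\<lambda>y. restrict (merge A B (y, g y)) A) ` Y"
        unfolding Z' map_graph_def image_image ..
      also have "\<dots> = (\<lambda>y. y) ` Y"
      proof (rule image_cong[OF refl])
        fix y assume "y \<in> Y"
        then show "restrict (merge A B (y, g y)) A = y"
          using D(6) by (auto simp: fun_eq_iff merge_def extensional_def)
      qed
      finally have Y: "(\<lambda>z. restrict z A) ` ?Z = Y" by simp
      have "powertop_real A interior_of Y = Y" using D(7) by (rule interior_of_openin)
      then have "powertop_real A interior_of ((\<lambda>z. restrict z A) ` ?Z) \<noteq> {}"
        unfolding Y using D(4) by simp
      then show "n - card I \<in> {card T | T. T \<subseteq> E \<and>
          powertop_real T interior_of ((\<lambda>z. restrict z T) ` ?Z) \<noteq> {}}"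
        using A AB by (intro CollectI exI[of _ A]) auto
    qed
  qed
qed

end
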